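(* For every $d\ge2$ there are constants $C_d,N_d>0$ such that for every centered, continuous, isotropic, log-concave density $f$ on $\mathbb{R}^d$ with $\mathrm{Cov}(f)=\sigma^2I_d$, $\sigma\ge N_d$, and all $1\le i,j\le d$ with $i\ne j$, $$\left|\sum_{k\in\mathbb{Z}^d}f(k)k_ik_j\right|\le C_d\,\sigma.$$
   Context: A density $f$ on $\mathbb{R}^d$ is log-concave if $f=e^{-V}$ with $V:\mathbb{R}^d\to\mathbb{R}\cup\{+\infty\}$ convex; centered if $\int xf(x)dx=0$; isotropic if its covariance matrix $\mathrm{Cov}(f)$ is $\sigma^2I_d$ for some $\sigma>0$. *)

theory Defs
  imports "HOL-Analysis.Analysis"
begin

definition is_density :: "('a::euclidean_space \<Rightarrow> real) \<Rightarrow> bool" where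
  "is_density f \<longleftrightarrow> (\<forall>x. 0 \<le> f x) \<and> has_bochner_integral lborel f 1"

text \<open>Convexity of a function into the reals extended by \<open>\<infinity>\<close>; the value \<open>-\<infinity>\<close> is excluded, so
  the right-hand side of the inequality never has the form \<open>\<infinity> - \<infinity>\<close>.\<close>

definition convex_extended :: "('a::real_vector \<Rightarrow> ereal) \<Rightarrow> bool" where
  "convex_extended V \<longleftrightarrow> (\<forall>x. V x \<noteq> -\<infinity>) \<and>
     (\<forall>x y. \<forall>t\<in>{0<..<1}.
        V ((1 - t) *\<^sub>R x + t *\<^sub>R y) \<le> ereal (1 - t) * V x + ereal t * V y)"

definition exp_neg :: "ereal \<Rightarrow> real" where
  "exp_neg v = (if v = \<infinity> then 0 else exp (- real_of_ereal v))"

definition log_concave :: "('a::real_vector \<Rightarrow> real) \<Rightarrow> bool" where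
  "log_concave f \<longleftrightarrow> (\<exists>V. convex_extended V \<and> (\<forall>x. f x = exp_neg (V x)))"

definition centered :: "('a::euclidean_space \<Rightarrow> real) \<Rightarrow> bool" where
  "centered f \<longleftrightarrow> has_bochner_integral lborel (\<lambda>x. f x *\<^sub>R x) 0"

definition density_mean :: "('a::euclidean_space \<Rightarrow> real) \<Rightarrow> 'a" where
  "density_mean f = (LINT x|lborel. f x *\<^sub>R x)"

text \<open>A Bochner integral that does not exist has the value \<open>0\<close>. If the matrix below has positive
  diagonal entries, then the second moments, hence all the integrals involved, do exist.\<close>

definition covariance_matrix :: "(real ^ 'n \<Rightarrow> real) \<Rightarrow> real ^ 'n ^ 'n" where
  "covariance_matrix f =
     (\<chi> i j. LINT x|lborel. f x * ((x - density_mean f) $ i * (x - density_mean f) $ j))"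

definition isotropic :: "(real ^ 'n \<Rightarrow> real) \<Rightarrow> bool" where
  "isotropic f \<longleftrightarrow> (\<exists>\<sigma>>0. covariance_matrix f = \<sigma>\<^sup>2 *\<^sub>R mat 1)"

definition of_int_vec :: "int ^ 'n \<Rightarrow> real ^ 'n" where
  "of_int_vec k = (\<chi> i. of_int (k $ i))"

end

theory Submission imports Defs begin

text \<open>
  Two facts are combined. First, an isotropic log-concave density satisfies
  \<open>f x \<le> C \<sigma>\<^sup>-\<^sup>d exp (- c |x| / \<sigma>)\<close>. The upper bound on \<open>f p\<close> holds because the superlevel set
  \<open>{f \<ge> \<lambda> f p}\<close> extends at least \<open>\<sigma> / 3\<close> from \<open>p\<close> in every direction, hence contains a parallelepiped
  of volume of order \<open>\<sigma>\<^sup>d\<close>; the decay follows from integrating the second moment over midpoints.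

  Second, a nonnegative quasiconcave function on the line bounded by \<open>B\<close> has an integral and a sum
  over the integers that differ by at most \<open>B\<close>: by the layer-cake formula this reduces to intervals,
  whose length and number of integer points differ by at most 1. Replacing Lebesgue measure by
  counting measure one coordinate at a time, each replacement in the integral of
  \<open>f x (\<plusminus>x\<^sub>i)\<^sup>+ (\<plusminus>x\<^sub>j)\<^sup>+\<close>, which is log-concave and bounded by
  \<open>C' \<sigma>\<^sup>2\<^sup>-\<^sup>d exp (- c' |x| / \<sigma>)\<close>, costs \<open>O(\<sigma>\<^sup>2\<^sup>-\<^sup>d \<sigma>\<^sup>d\<^sup>-\<^sup>1) = O(\<sigma>)\<close>. The signed sum of
  the four integrals is the covariance, which vanishes.
\<close>

section \<open>Lebesgue and counting measure on the line\<close>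

text \<open>Counting measure is pushed forward to the real line so that it shares the Borel sets
  with \<open>lborel\<close> and can replace it as a single factor of a product measure.\<close>

definition int_measure :: "real measure" where
  "int_measure = distr (count_space (UNIV :: int set)) borel of_int"

lemma sets_int_measure [simp, measurable_cong]: "sets int_measure = sets borel"
  by (simp add: int_measure_def)

lemma space_int_measure [simp]: "space int_measure = UNIV"
  by (simp add: int_measure_def)

lemma emeasure_int_measure:
  assumes "X \<in> sets borel"
  shows "emeasure int_measure X = emeasure (count_space UNIV) {k::int. real_of_int k \<in> X}"
  using assms by (simp add: int_measure_def emeasure_distr vimage_def)

lemma sigma_finite_int_measure: "sigma_finite_measure int_measure"
proof
  let ?A = "range (\<lambda>n::nat. {- real n .. real n})"
  have "\<Union>?A = UNIV"
  proof -
    have "x \<in> \<Union>?A" for x :: real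
    proof -
      obtain n :: nat where "\<bar>x\<bar> \<le> real n" using real_arch_simple by blast
      then show ?thesis by (auto intro!: exI[of _ n])
    qed
    then show ?thesis by blast
  qed
  moreover have "emeasure int_measure {- real n .. real n} \<noteq> \<infinity>" for n
  proof -
    have "{k::int. real_of_int k \<in> {- real n .. real n}} = {- int n .. int n}"
      by auto
    then show ?thesis by (simp add: emeasure_int_measure)
  qed
  ultimately show "\<exists>A. countable A \<and> A \<subseteq> sets int_measure \<and> \<Union> A = space int_measure
      \<and> (\<forall>a\<in>A. emeasure int_measure a \<noteq> \<infinity>)"
    by (intro exI[of _ ?A]) auto
qed

text \<open>A finite set of integers in \<open>I\<close> with least element \<open>p\<close> and
  greatest element \<open>q\<close> has at most \<open>q - p + 1\<close> elements, while
  \<open>I\<close> contains all of \<open>{p..q}\<close>. Arguing with finite subsets also settles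
  the infinite case: arbitrarily large ones force the length to be infinite.\<close>

lemma emeasure_int_measure_interval_le:
  fixes I :: "real set"
  assumes I: "is_interval I"
  shows "emeasure int_measure I \<le> emeasure lborel I + 1"
proof -
  have bI: "I \<in> sets borel" using I by (rule real_interval_borel_measurable)
  define Z where "Z = {k::int. real_of_int k \<in> I}"
  have bound: "of_nat (card F) \<le> emeasure lborel I + 1" if F: "finite F" "F \<subseteq> Z" for F
  proof (cases "F = {}")
    case False
    define p q where "p = Min F" and "q = Max F"
    have pq: "p \<in> F" "q \<in> F" "F \<subseteq> {p..q}"
      using F False by (auto simp: p_def q_def)
    have "p \<le> q" using pq by auto
    have "card F \<le> nat (q - p + 1)"
      using card_mono[OF _ pq(3)] by simp
    also have "nat (q - p + 1) = nat (q - p) + 1" using \<open>p \<le> q\<close> by simp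
    finally have "(of_nat (card F) :: ennreal) \<le> of_nat (nat (q - p) + 1)"
      by (rule of_nat_mono)
    also have "\<dots> = ennreal (real_of_int q - real_of_int p) + 1"
      using \<open>p \<le> q\<close> by (simp add: ennreal_of_nat_eq_real_of_nat)
    also have "ennreal (real_of_int q - real_of_int p) = emeasure lborel {real_of_int p .. real_of_int q}"
      using \<open>p \<le> q\<close> by simp
    also have "\<dots> + 1 \<le> emeasure lborel I + 1"
    proof (intro add_right_mono emeasure_mono)
      have "real_of_int p \<in> I" "real_of_int q \<in> I" using pq F by (auto simp: Z_def)
      then show "{real_of_int p .. real_of_int q} \<subseteq> I"
        using I unfolding is_interval_1 by (meson atLeastAtMost_iff subsetI)
    qed (use bI in simp)
    finally show ?thesis .
  qed simp
  show ?thesis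
  proof (cases "finite Z")
    case True
    then show ?thesis using bound[of Z] bI by (simp add: emeasure_int_measure Z_def)
  next
    case False
    have "(of_nat n :: ennreal) \<le> emeasure lborel I + 1" for n
      using infinite_arbitrarily_large[OF False, of n] bound by auto
    then have "emeasure lborel I + 1 = top"
      by (metis ennreal_Ex_less_of_nat linorder_not_less top.not_eq_extremum)
    then show ?thesis by simp
  qed
qed

text \<open>If \<open>{p..q}\<close> are the integers in \<open>I\<close>, then \<open>I\<close>
  cannot reach beyond \<open>p - 1\<close> or \<open>q + 1\<close>, so its length is at most
  \<open>q - p + 2\<close>, one more than the count. An interval without integers lies between two
  consecutive ones.\<close>

lemma emeasure_lborel_interval_le:
  fixes I :: "real set"
  assumes I: "is_interval I"
  shows "emeasure lborel I \<le> emeasure int_measure I + 1"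
proof -
  have bI: "I \<in> sets borel" using I by (rule real_interval_borel_measurable)
  define Z where "Z = {k::int. real_of_int k \<in> I}"
  have eq: "emeasure int_measure I = emeasure (count_space UNIV) Z"
    using bI by (simp add: emeasure_int_measure Z_def)
  consider "infinite Z" | "Z = {}" | "finite Z" "Z \<noteq> {}" by blast
  then show ?thesis
  proof cases
    case 1
    then show ?thesis by (simp add: eq)
  next
    case 2
    show ?thesis
    proof (cases "I = {}")
      case False
      then obtain x where x: "x \<in> I" by blast
      have "I \<subseteq> {real_of_int \<lfloor>x\<rfloor> .. real_of_int (\<lfloor>x\<rfloor> + 1)}"
      proof
        fix y assume y: "y \<in> I"
        have "\<not> y < real_of_int \<lfloor>x\<rfloor>"
        proof
          assume "y < real_of_int \<lfloor>x\<rfloor>"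
          then have "y \<le> real_of_int \<lfloor>x\<rfloor>" "real_of_int \<lfloor>x\<rfloor> \<le> x" by simp_all
          then have "real_of_int \<lfloor>x\<rfloor> \<in> I"
            using I x y unfolding is_interval_1 by blast
          then show False using 2 by (auto simp: Z_def)
        qed
        moreover have "\<not> real_of_int (\<lfloor>x\<rfloor> + 1) < y"
        proof
          assume "real_of_int (\<lfloor>x\<rfloor> + 1) < y"
          then have "real_of_int (\<lfloor>x\<rfloor> + 1) \<le> y" "x \<le> real_of_int (\<lfloor>x\<rfloor> + 1)" by linarith+
          then have "real_of_int (\<lfloor>x\<rfloor> + 1) \<in> I"
            using I x y unfolding is_interval_1 by blast
          then have "\<lfloor>x\<rfloor> + 1 \<in> Z" by (simp only: Z_def mem_Collect_eq)
          then show False using 2 by simp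
        qed
        ultimately show "y \<in> {real_of_int \<lfloor>x\<rfloor> .. real_of_int (\<lfloor>x\<rfloor> + 1)}" by auto
      qed
      then have "emeasure lborel I \<le> emeasure lborel {real_of_int \<lfloor>x\<rfloor> .. real_of_int (\<lfloor>x\<rfloor> + 1)}"
        by (intro emeasure_mono) auto
      also have "\<dots> = 1" by simp
      finally show ?thesis by (rule order_trans) (simp add: add_increasing)
    qed simp
  next
    case 3
    define p q where "p = Min Z" and "q = Max Z"
    have pq: "p \<in> Z" "q \<in> Z" "Z \<subseteq> {p..q}"
      using 3 by (auto simp: p_def q_def)
    have "p \<le> q" using pq by auto
    have pI: "real_of_int p \<in> I" "real_of_int q \<in> I" using pq by (auto simp: Z_def)
    then have "real_of_int k \<in> I" if "k \<in> {p..q}" for k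
      using I that unfolding is_interval_1 by (meson atLeastAtMost_iff of_int_le_iff)
    then have Zeq: "Z = {p..q}" using pq by (auto simp: Z_def)
    have "I \<subseteq> {real_of_int (p - 1) .. real_of_int (q + 1)}"
    proof
      fix y assume y: "y \<in> I"
      have "\<not> y < real_of_int (p - 1)"
      proof
        assume "y < real_of_int (p - 1)"
        then have "y \<le> real_of_int (p - 1)" "real_of_int (p - 1) \<le> real_of_int p" by simp_all
        then have "real_of_int (p - 1) \<in> I"
          using I pI y unfolding is_interval_1 by blast
        then have "p - 1 \<in> Z" by (simp only: Z_def mem_Collect_eq)
        then show False using Zeq by auto
      qed
      moreover have "\<not> real_of_int (q + 1) < y"
      proof
        assume "real_of_int (q + 1) < y"
        then have "real_of_int (q + 1) \<le> y" "real_of_int q \<le> real_of_int (q + 1)" by simp_all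
        then have "real_of_int (q + 1) \<in> I"
          using I pI y unfolding is_interval_1 by blast
        then have "q + 1 \<in> Z" by (simp only: Z_def mem_Collect_eq)
        then show False using Zeq by auto
      qed
      ultimately show "y \<in> {real_of_int (p - 1) .. real_of_int (q + 1)}" by auto
    qed
    then have "emeasure lborel I \<le> emeasure lborel {real_of_int (p - 1) .. real_of_int (q + 1)}"
      by (intro emeasure_mono) auto
    also have "\<dots> = ennreal (real (nat (q - p + 1)) + 1)"
      using \<open>p \<le> q\<close> by simp
    also have "\<dots> = of_nat (nat (q - p + 1)) + 1"
      by (simp add: ennreal_of_nat_eq_real_of_nat)
    also have "of_nat (nat (q - p + 1)) = emeasure int_measure I"
      by (simp add: eq Zeq)
    finally show ?thesis .
  qed
qed

text \<open>Tonelli for the region under the graph of \<open>u\<close>. The levels are cut off at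
  \<open>B\<close>, so that an error of 1 at every level adds up to \<open>B\<close>.\<close>

lemma nn_integral_layer_cake:
  fixes u :: "real \<Rightarrow> real"
  assumes M: "sigma_finite_measure M" and sM [measurable_cong]: "sets M = sets borel"
    and [measurable]: "u \<in> borel_measurable borel" and u: "\<And>x. 0 \<le> u x" "\<And>x. u x \<le> B"
  shows "(\<integral>\<^sup>+x. ennreal (u x) \<partial>M)
    = (\<integral>\<^sup>+s. emeasure M {x. s < u x} * indicator {0..<B} s \<partial>lborel)"
proof -
  interpret M: sigma_finite_measure M by (rule M)
  interpret P: pair_sigma_finite M lborel ..
  have sp: "space M = UNIV" using sets_eq_imp_space_eq[OF sM] by simp
  have "ennreal (u x) = (\<integral>\<^sup>+s. indicator {0..<u x} s \<partial>lborel)" for x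
    using u[of x] by simp
  then have "(\<integral>\<^sup>+x. ennreal (u x) \<partial>M) = (\<integral>\<^sup>+x. \<integral>\<^sup>+s. indicator {0..<u x} s \<partial>lborel \<partial>M)"
    by simp
  also have "\<dots> = (\<integral>\<^sup>+s. \<integral>\<^sup>+x. indicator {0..<u x} s \<partial>M \<partial>lborel)"
  proof (rule P.Fubini'[symmetric])
    have "(\<lambda>p. indicator {p. 0 \<le> snd p \<and> snd p < u (fst p)} p :: ennreal) \<in> borel_measurable (M \<Otimes>\<^sub>M lborel)"
      by measurable
    then show "(\<lambda>(x, s). indicator {0..<u x} s :: ennreal) \<in> borel_measurable (M \<Otimes>\<^sub>M lborel)"
      by (rule back_subst[of "\<lambda>g. g \<in> borel_measurable (M \<Otimes>\<^sub>M lborel)"]) (auto simp: fun_eq_iff indicator_def)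
  qed
  also have "\<dots> = (\<integral>\<^sup>+s. emeasure M {x. s < u x} * indicator {0..<B} s \<partial>lborel)"
  proof (rule nn_integral_cong)
    fix s :: real
    have meas: "{x. s < u x} \<in> sets M" using sM by measurable
    have "indicator {0..<u x} s = (indicator {0..<B} s * indicator {x. s < u x} x :: ennreal)" for x
      using u(2)[of x] by (auto simp: indicator_def)
    then have "(\<integral>\<^sup>+x. indicator {0..<u x} s \<partial>M)
        = (\<integral>\<^sup>+x. indicator {0..<B} s * indicator {x. s < u x} x \<partial>M)" by simp
    also have "\<dots> = indicator {0..<B} s * emeasure M {x. s < u x}"
      using meas by (simp add: nn_integral_cmult)
    finally show "(\<integral>\<^sup>+x. indicator {0..<u x} s \<partial>M) = emeasure M {x. s < u x} * indicator {0..<B} s"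
      by (simp add: mult.commute)
  qed
  finally show ?thesis .
qed

text \<open>Superlevel sets of \<open>u\<close> are intervals, whose two measures differ by at most
  1; integrate over the levels. \<open>M\<close> and \<open>N\<close> range over both measures, so
  one statement serves for both directions.\<close>

lemma nn_integral_quasiconcave_le:
  fixes u :: "real \<Rightarrow> real"
  assumes MN: "M \<in> {lborel, int_measure}" "N \<in> {lborel, int_measure}"
    and [measurable]: "u \<in> borel_measurable borel" and u: "\<And>x. 0 \<le> u x" "\<And>x. u x \<le> B"
    and qc: "\<And>a b c. a \<le> b \<Longrightarrow> b \<le> c \<Longrightarrow> min (u a) (u c) \<le> u b"
  shows "(\<integral>\<^sup>+x. ennreal (u x) \<partial>M) \<le> (\<integral>\<^sup>+x. ennreal (u x) \<partial>N) + ennreal B"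
proof -
  have sM: "sigma_finite_measure M" "sets M = sets borel" "sigma_finite_measure N" "sets N = sets borel"
    using MN sigma_finite_int_measure sigma_finite_lborel by auto
  have int: "is_interval {x. s < u x}" for s
    unfolding is_interval_1 using qc by (auto simp: min_def) (smt (verit, best))
  have "(\<integral>\<^sup>+x. ennreal (u x) \<partial>M)
      = (\<integral>\<^sup>+s. emeasure M {x. s < u x} * indicator {0..<B} s \<partial>lborel)"
    by (rule nn_integral_layer_cake) (use sM u in auto)
  also have "\<dots> \<le> (\<integral>\<^sup>+s. emeasure N {x. s < u x} * indicator {0..<B} s + indicator {0..<B} s \<partial>lborel)"
  proof (rule nn_integral_mono)
    fix s :: real
    have "emeasure M {x. s < u x} \<le> emeasure N {x. s < u x} + 1"
      using MN emeasure_int_measure_interval_le[OF int, of s] emeasure_lborel_interval_le[OF int, of s]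
      by (auto simp: add_increasing2)
    then have "emeasure M {x. s < u x} * indicator {0..<B} s
        \<le> (emeasure N {x. s < u x} + 1) * indicator {0..<B} s"
      by (rule mult_right_mono) simp
    then show "emeasure M {x. s < u x} * indicator {0..<B} s
        \<le> emeasure N {x. s < u x} * indicator {0..<B} s + indicator {0..<B} s"
      by (simp add: distrib_right)
  qed
  also have "\<dots> = (\<integral>\<^sup>+s. emeasure N {x. s < u x} * indicator {0..<B} s \<partial>lborel) + ennreal B"
  proof -
    interpret N: sigma_finite_measure N by (rule sM)
    have [measurable_cong]: "sets N = sets borel" by (rule sM)
    have sp: "space N = UNIV" using sets_eq_imp_space_eq[OF sM(4)] by simp
    \<comment> \<open>The superlevel sets are the sections of one measurable set in the plane, hence
      their measure is measurable in \<open>s\<close>.\<close>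
    have "(\<lambda>s. emeasure N (Pair s -` {p\<in>space (lborel \<Otimes>\<^sub>M N). fst p < u (snd p)})) \<in> borel_measurable lborel"
      by (rule N.measurable_emeasure_Pair) measurable
    then have [measurable]: "(\<lambda>s. emeasure N {x. s < u x}) \<in> borel_measurable borel"
      by (simp add: space_pair_measure sp)
    have "0 \<le> B" using u[of 0] by linarith
    then show ?thesis by (subst nn_integral_add) auto
  qed
  also have "(\<integral>\<^sup>+s. emeasure N {x. s < u x} * indicator {0..<B} s \<partial>lborel) = (\<integral>\<^sup>+x. ennreal (u x) \<partial>N)"
    by (rule nn_integral_layer_cake[symmetric]) (use sM u in auto)
  finally show ?thesis .
qed

text \<open>The two half-lines contribute \<open>2 / a\<close> for Lebesgue measure. Passing to
  counting measure costs the maximum 1, which is at most \<open>1 / a\<close>.\<close>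

lemma nn_integral_exp_abs_le:
  assumes a: "0 < a" "a \<le> 1" and M: "M \<in> {lborel, int_measure}"
  shows "(\<integral>\<^sup>+t. ennreal (exp (- (a * \<bar>t\<bar>))) \<partial>M) \<le> ennreal (3 / a)"
proof -
  have half: "(\<integral>\<^sup>+t. ennreal (exp (- (a * t))) * indicator {0..} t \<partial>lborel) = ennreal (1 / a)"
  proof -
    have "(\<integral>\<^sup>+t. ennreal (exp (- (a * t))) * indicator {0..} t \<partial>lborel)
        = ennreal (0 - (- exp (- (a * 0)) / a))"
    proof (rule nn_integral_FTC_atLeast)
      show "((\<lambda>t. - exp (- (a * t)) / a) \<longlongrightarrow> 0) at_top"
      proof -
        have "filterlim (\<lambda>t. - (a * t)) at_bot at_top"
          using a by (simp add: filterlim_uminus_at_bot filterlim_tendsto_pos_mult_at_top[OF tendsto_const] filterlim_ident)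
        then have "((\<lambda>t. exp (- (a * t))) \<longlongrightarrow> 0) at_top"
          by (rule filterlim_compose[OF exp_at_bot])
        then have "((\<lambda>t. - exp (- (a * t)) / a) \<longlongrightarrow> - 0 / a) at_top"
          using a by (intro tendsto_intros) auto
        then show ?thesis by simp
      qed
    qed (use a in \<open>auto intro!: derivative_eq_intros\<close>)
    then show ?thesis by simp
  qed
  have neg: "(\<integral>\<^sup>+t. ennreal (exp (- (a * \<bar>t\<bar>))) * indicator {..0} t \<partial>lborel) = ennreal (1 / a)"
  proof -
    have "(\<integral>\<^sup>+t. ennreal (exp (- (a * \<bar>t\<bar>))) * indicator {..0} t \<partial>lborel)
       = (\<integral>\<^sup>+t. ennreal (exp (- (a * \<bar>- t\<bar>))) * indicator {..0} (- t) \<partial>lborel)"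
      by (subst nn_integral_real_affine[where c="-1" and t=0]) auto
    also have "\<dots> = (\<integral>\<^sup>+t. ennreal (exp (- (a * t))) * indicator {0..} t \<partial>lborel)"
      by (rule nn_integral_cong) (auto simp: indicator_def)
    finally show ?thesis using half by simp
  qed
  have "(\<integral>\<^sup>+t. ennreal (exp (- (a * \<bar>t\<bar>))) \<partial>lborel)
     \<le> (\<integral>\<^sup>+t. ennreal (exp (- (a * t))) * indicator {0..} t
           + ennreal (exp (- (a * \<bar>t\<bar>))) * indicator {..0} t \<partial>lborel)"
    by (rule nn_integral_mono) (auto simp: indicator_def)
  also have "\<dots> = ennreal (1 / a) + ennreal (1 / a)"
    by (subst nn_integral_add) (auto simp: half neg)
  also have "\<dots> = ennreal (2 / a)" using a by (simp flip: ennreal_plus)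
  finally have leb: "(\<integral>\<^sup>+t. ennreal (exp (- (a * \<bar>t\<bar>))) \<partial>lborel) \<le> ennreal (2 / a)" .
  have "(\<integral>\<^sup>+t. ennreal (exp (- (a * \<bar>t\<bar>))) \<partial>M)
      \<le> (\<integral>\<^sup>+t. ennreal (exp (- (a * \<bar>t\<bar>))) \<partial>lborel) + ennreal 1"
  proof (rule nn_integral_quasiconcave_le)
    fix x y z :: real assume "x \<le> y" "y \<le> z"
    then have "\<bar>y\<bar> \<le> \<bar>x\<bar> \<or> \<bar>y\<bar> \<le> \<bar>z\<bar>" by linarith
    then show "min (exp (- (a * \<bar>x\<bar>))) (exp (- (a * \<bar>z\<bar>))) \<le> exp (- (a * \<bar>y\<bar>))"
      using a by (auto simp: min_le_iff_disj)
  qed (use M a in auto)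
  also have "\<dots> \<le> ennreal (2 / a) + ennreal (1 / a)"
    using a by (intro add_mono leb ennreal_leI) (simp add: field_simps)
  also have "\<dots> = ennreal (3 / a)" using a by (simp flip: ennreal_plus)
  finally show ?thesis .
qed

section \<open>Integrals over product measures\<close>

lemma measurable_vec_lambda_PiM [measurable]:
  assumes "\<And>i. sets (M i) = sets (borel :: real measure)"
  shows "(\<lambda>x. \<chi> i::'n::finite. x i) \<in> borel_measurable (Pi\<^sub>M UNIV M)"
proof -
  have "(\<lambda>x. x i) \<in> borel_measurable (Pi\<^sub>M UNIV M)" for i
    using measurable_component_singleton[of i UNIV M] assms[of i]
    by (metis UNIV_I measurable_cong_sets)
  then show ?thesis
    by (subst borel_measurable_euclidean_space) (auto simp: Basis_vec_def inner_axis)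
qed

text \<open>\<open>lborel\<close> is determined by its values on boxes, and the preimage of a box is
  a product of intervals.\<close>

lemma lborel_vec_eq_distr:
  "(lborel :: (real^'n) measure) = distr (Pi\<^sub>M UNIV (\<lambda>_::'n::finite. lborel)) borel (\<lambda>x. \<chi> i. x i)"
proof (rule lborel_eqI)
  fix l u :: "real^'n" assume le: "\<And>b. b \<in> Basis \<Longrightarrow> l \<bullet> b \<le> u \<bullet> b"
  interpret product_sigma_finite "\<lambda>_::'n. lborel :: real measure" ..
  have le': "l $ i \<le> u $ i" for i
    using le[of "axis i 1"] by (auto simp: Basis_vec_def inner_axis)
  have "(\<lambda>x. \<chi> i. x i) -` box l u \<inter> space (Pi\<^sub>M UNIV (\<lambda>_::'n. lborel)) = (\<Pi>\<^sub>E i\<in>UNIV. {l $ i <..< u $ i})"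
    by (auto simp: mem_box_cart space_PiM PiE_def Pi_def)
  then have "emeasure (distr (Pi\<^sub>M UNIV (\<lambda>_::'n. lborel)) borel (\<lambda>x. \<chi> i. x i)) (box l u)
      = emeasure (Pi\<^sub>M UNIV (\<lambda>_::'n. lborel)) (\<Pi>\<^sub>E i\<in>UNIV. {l $ i <..< u $ i})"
    by (subst emeasure_distr) (auto intro: measurable_vec_lambda_PiM)
  also have "\<dots> = (\<Prod>i\<in>UNIV. ennreal (u $ i - l $ i))"
    using le' by (subst emeasure_PiM) (auto intro!: prod.cong)
  also have "\<dots> = ennreal (\<Prod>i\<in>UNIV. u $ i - l $ i)"
    using le' by (intro prod_ennreal) auto
  also have "(\<Prod>i\<in>UNIV. u $ i - l $ i) = (\<Prod>b\<in>Basis. (u - l) \<bullet> b)"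
  proof -
    have "(\<Prod>b\<in>Basis. (u - l) \<bullet> b) = (\<Prod>b\<in>range (\<lambda>i::'n. axis i (1::real)). (u - l) \<bullet> b)"
      by (rule prod.cong) (auto simp: Basis_vec_def)
    also have "\<dots> = (\<Prod>i\<in>UNIV. (u - l) \<bullet> axis i 1)"
      by (subst prod.reindex) (auto simp: inj_on_def axis_eq_axis)
    finally show ?thesis by (simp add: inner_axis)
  qed
  finally show "emeasure (distr (Pi\<^sub>M UNIV (\<lambda>_::'n. lborel)) borel (\<lambda>x. \<chi> i. x i)) (box l u)
      = ennreal (\<Prod>b\<in>Basis. (u - l) \<bullet> b)" .
qed simp

lemma product_sigma_finite_int_measure:
  assumes "\<And>i. M i \<in> {lborel, int_measure}"
  shows "product_sigma_finite M"
proof (rule product_sigma_finite.intro)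
  show "sigma_finite_measure (M i)" for i
    using assms[of i] sigma_finite_int_measure sigma_finite_lborel by auto
qed

text \<open>The cases follow the convention that 0 times infinity is 0: an empty factor annihilates
  the product even beside an infinite one, and without empty factors one infinite factor makes both
  sides infinite.\<close>

lemma emeasure_count_space_PiE:
  fixes X :: "'n::finite \<Rightarrow> 'b set"
  shows "emeasure (count_space UNIV) {k. \<forall>i. k i \<in> X i} = (\<Prod>i\<in>UNIV. emeasure (count_space UNIV) (X i))"
proof -
  have eq: "{k. \<forall>i. k i \<in> X i} = (\<Pi>\<^sub>E i\<in>UNIV. X i)" by auto
  consider "\<forall>i. finite (X i)" | "\<exists>i. X i = {}" | "\<forall>i. X i \<noteq> {}" "\<exists>i. infinite (X i)" by blast
  then show ?thesis
  proof cases
    case 1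
    then have "finite (\<Pi>\<^sub>E i\<in>UNIV. X i)" by (intro finite_PiE) auto
    with 1 show ?thesis unfolding eq by (simp add: card_PiE)
  next
    case 2
    then obtain i where i: "X i = {}" by blast
    then have "emeasure (count_space UNIV) (X i) = 0" by simp
    then have "(\<Prod>i\<in>UNIV. emeasure (count_space UNIV) (X i)) = 0"
      by (intro prod_zero) auto
    moreover have "{k. \<forall>i. k i \<in> X i} = {}" using i by blast
    ultimately show ?thesis by (simp only: emeasure_empty)
  next
    case 3
    then have "infinite (\<Pi>\<^sub>E i\<in>UNIV. X i)" by (subst finite_PiE_iff) (auto simp: PiE_eq_empty_iff)
    moreover have "(\<Prod>i\<in>UNIV. emeasure (count_space UNIV) (X i)) = \<infinity>"
    proof -
      have "emeasure (count_space UNIV) (X i) \<noteq> 0" for i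
        using 3 by (simp add: emeasure_count_space_eq_0)
      moreover have "\<exists>i. emeasure (count_space UNIV) (X i) = top" using 3 by (auto intro: emeasure_count_space_infinite[unfolded infinity_ennreal_def])
      ultimately show ?thesis by (simp add: ennreal_prod_eq_top)
    qed
    ultimately show ?thesis unfolding eq by simp
  qed
qed

text \<open>A product of sigma-finite measures is determined by its values on product sets, and
  there the count of lattice points factorises.\<close>

lemma PiM_int_measure:
  "Pi\<^sub>M UNIV (\<lambda>_::'n::finite. int_measure)
     = distr (count_space (UNIV :: (int^'n) set)) (Pi\<^sub>M UNIV (\<lambda>_. borel)) (\<lambda>k i. real_of_int (k $ i))"
proof -
  interpret product_sigma_finite "\<lambda>_::'n. int_measure"
    by (rule product_sigma_finite_int_measure) simp
  show ?thesis
  proof (rule PiM_eqI[symmetric])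
    show "sets (distr (count_space (UNIV :: (int^'n) set)) (Pi\<^sub>M UNIV (\<lambda>_. borel)) (\<lambda>k i. real_of_int (k $ i)))
        = sets (Pi\<^sub>M UNIV (\<lambda>_::'n. int_measure))"
      by (simp, rule sets_PiM_cong) auto
    fix X :: "'n \<Rightarrow> real set" assume X: "\<And>i. i \<in> UNIV \<Longrightarrow> X i \<in> sets int_measure"
    have meas: "Pi\<^sub>E UNIV X \<in> sets (Pi\<^sub>M UNIV (\<lambda>_::'n. borel))"
      using X by (intro sets_PiM_I_finite) auto
    have bij: "bij_betw (\<lambda>k i. k $ i) {k :: int^'n. \<forall>i. real_of_int (k $ i) \<in> X i}
        {k. \<forall>i. k i \<in> {z::int. real_of_int z \<in> X i}}"
      by (rule bij_betw_byWitness[where f'="\<lambda>k. \<chi> i. k i"]) auto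
    have "emeasure (distr (count_space (UNIV :: (int^'n) set)) (Pi\<^sub>M UNIV (\<lambda>_. borel)) (\<lambda>k i. real_of_int (k $ i))) (Pi\<^sub>E UNIV X)
        = emeasure (count_space UNIV) {k :: int^'n. \<forall>i. real_of_int (k $ i) \<in> X i}"
      by (subst emeasure_distr[OF _ meas])
        (auto simp: space_PiM intro!: arg_cong[where f="emeasure _"])
    also have "\<dots> = emeasure (count_space UNIV) {k. \<forall>i. k i \<in> {z::int. real_of_int z \<in> X i}}"
      using bij_betw_finite[OF bij] bij_betw_same_card[OF bij]
      by (simp only: emeasure_count_space subset_UNIV)
    also have "\<dots> = (\<Prod>i\<in>UNIV. emeasure (count_space UNIV) {z::int. real_of_int z \<in> X i})"
      by (rule emeasure_count_space_PiE)
    also have "\<dots> = (\<Prod>i\<in>UNIV. emeasure int_measure (X i))"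
      using X by (simp add: emeasure_int_measure)
    finally show "emeasure (distr (count_space (UNIV :: (int^'n) set)) (Pi\<^sub>M UNIV (\<lambda>_. borel)) (\<lambda>k i. real_of_int (k $ i))) (Pi\<^sub>E UNIV X)
        = (\<Prod>i\<in>UNIV. emeasure int_measure (X i))" .
  qed simp
qed

text \<open>Fubini isolates the coordinate \<open>l\<close>. On each line in that direction
  \<open>G\<close> is quasiconcave, so the exchange costs at most the bound \<open>b x\<close>,
  which depends on the other coordinates only; integrating \<open>b\<close> gives one factor
  \<open>3 / a\<close> for each of them.\<close>

lemma nn_integral_PiM_change_le:
  fixes G :: "real^'n::finite \<Rightarrow> real" and M N :: "'n \<Rightarrow> real measure"
  assumes M: "\<And>i. M i \<in> {lborel, int_measure}" and N: "\<And>i. N i \<in> {lborel, int_measure}"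
    and agree: "\<And>i. i \<noteq> l \<Longrightarrow> M i = N i"
    and G [measurable]: "G \<in> borel_measurable borel" and G0: "\<And>x. 0 \<le> G x"
    and qc: "\<And>x y t. 0 \<le> t \<Longrightarrow> t \<le> 1 \<Longrightarrow> min (G x) (G y) \<le> G ((1 - t) *\<^sub>R x + t *\<^sub>R y)"
    and a: "0 < a" "a \<le> 1" and K: "0 \<le> K"
    and bound: "\<And>x. G x \<le> K * (\<Prod>i\<in>UNIV. exp (- (a * \<bar>x $ i\<bar>)))"
  shows "(\<integral>\<^sup>+x. ennreal (G (\<chi> i. x i)) \<partial>Pi\<^sub>M UNIV M)
    \<le> (\<integral>\<^sup>+x. ennreal (G (\<chi> i. x i)) \<partial>Pi\<^sub>M UNIV N) + ennreal (K * (3 / a) ^ (CARD('n) - 1))"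
proof -
  interpret M: product_sigma_finite M by (rule product_sigma_finite_int_measure[OF M])
  interpret N: product_sigma_finite N by (rule product_sigma_finite_int_measure[OF N])
  define J where "J = - {l}"
  have J: "finite J" "l \<notin> J" and U: "UNIV = insert l J" by (auto simp: J_def)
  have sM: "sets (M i) = sets borel" and sN: "sets (N i) = sets borel" for i
    using M[of i] N[of i] by auto
  have PJ: "Pi\<^sub>M J M = Pi\<^sub>M J N" by (rule PiM_cong) (auto simp: J_def agree)
  have mG: "(\<lambda>x. ennreal (G (\<chi> i. x i))) \<in> borel_measurable (Pi\<^sub>M (insert l J) M')"
    if "\<And>i. sets (M' i) = sets borel" for M'
    unfolding U[symmetric] using measurable_compose[OF measurable_vec_lambda_PiM[OF that] G] by simp
  define h where "h x y = ennreal (G (\<chi> i. (x(l := y)) i))" for x :: "'n \<Rightarrow> real" and y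
  define b where "b x = K * (\<Prod>i\<in>J. exp (- (a * \<bar>x i\<bar>)))" for x :: "'n \<Rightarrow> real"
  have sect: "(\<integral>\<^sup>+y. h x y \<partial>M l) \<le> (\<integral>\<^sup>+y. h x y \<partial>N l) + ennreal (b x)" for x
    unfolding h_def
  proof (rule nn_integral_quasiconcave_le)
    let ?v = "\<lambda>y. \<chi> i. (x(l := y)) i"
    show "(\<lambda>y. G (?v y)) \<in> borel_measurable borel"
    proof (rule measurable_compose[OF _ G])
      show "?v \<in> borel_measurable borel"
        by (subst borel_measurable_euclidean_space) (auto simp: Basis_vec_def inner_axis)
    qed
    fix y
    have "G (?v y) \<le> K * (\<Prod>i\<in>insert l J. exp (- (a * \<bar>?v y $ i\<bar>)))"
      using bound[of "?v y"] by (simp only: U)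
    also have "(\<Prod>i\<in>insert l J. exp (- (a * \<bar>?v y $ i\<bar>))) = exp (- (a * \<bar>y\<bar>)) * (\<Prod>i\<in>J. exp (- (a * \<bar>?v y $ i\<bar>)))"
      using J by simp
    also have "(\<Prod>i\<in>J. exp (- (a * \<bar>?v y $ i\<bar>))) = (\<Prod>i\<in>J. exp (- (a * \<bar>x i\<bar>)))"
      using J by (intro prod.cong) auto
    \<comment> \<open>Bounding the factor of coordinate \<open>l\<close> by 1 makes the bound
      uniform along the line.\<close>
    also have "exp (- (a * \<bar>y\<bar>)) * (\<Prod>i\<in>J. exp (- (a * \<bar>x i\<bar>))) \<le> 1 * (\<Prod>i\<in>J. exp (- (a * \<bar>x i\<bar>)))"
      using a by (intro mult_right_mono prod_nonneg) auto
    finally show "G (?v y) \<le> b x" using K by (simp add: b_def mult_left_mono)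
  next
    fix p q r :: real assume pqr: "p \<le> q" "q \<le> r"
    let ?v = "\<lambda>y. \<chi> i. (x(l := y)) i"
    show "min (G (?v p)) (G (?v r)) \<le> G (?v q)"
    proof (cases "p = r")
      case False
      \<comment> \<open>The parameter at which the segment from \<open>p\<close> to \<open>r\<close>
        passes through \<open>q\<close>.\<close>
      define t where "t = (q - p) / (r - p)"
      have t: "0 \<le> t" "t \<le> 1" "t * (r - p) = q - p"
        using pqr False by (auto simp: t_def)
      have "?v q = (1 - t) *\<^sub>R ?v p + t *\<^sub>R ?v r"
        using t(3) by (auto simp: vec_eq_iff algebra_simps)
      then show ?thesis using qc[OF t(1,2)] by metis
    qed (use pqr in auto)
  qed (use M N G0 in auto)
  have "(\<integral>\<^sup>+x. ennreal (G (\<chi> i. x i)) \<partial>Pi\<^sub>M UNIV M) = (\<integral>\<^sup>+x. (\<integral>\<^sup>+y. h x y \<partial>M l) \<partial>Pi\<^sub>M J M)"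
    unfolding h_def U by (rule M.product_nn_integral_insert[OF J mG[OF sM]])
  also have "\<dots> \<le> (\<integral>\<^sup>+x. (\<integral>\<^sup>+y. h x y \<partial>N l) + ennreal (b x) \<partial>Pi\<^sub>M J N)"
    unfolding PJ by (rule nn_integral_mono) (rule sect)
  also have "\<dots> = (\<integral>\<^sup>+x. (\<integral>\<^sup>+y. h x y \<partial>N l) \<partial>Pi\<^sub>M J N) + (\<integral>\<^sup>+x. ennreal (b x) \<partial>Pi\<^sub>M J N)"
  proof (rule nn_integral_add)
    have "(\<lambda>(x, y). h x y) \<in> borel_measurable (Pi\<^sub>M J N \<Otimes>\<^sub>M N l)"
      unfolding h_def using measurable_compose[OF measurable_add_dim[of l J N] mG[OF sN]]
      by (simp add: split_def fun_upd_def)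
    then show "(\<lambda>x. \<integral>\<^sup>+y. h x y \<partial>N l) \<in> borel_measurable (Pi\<^sub>M J N)"
      by (rule sigma_finite_measure.borel_measurable_nn_integral[OF N.sigma_finite_measures])
    have "(\<lambda>x. x i) \<in> borel_measurable (Pi\<^sub>M J N)" if "i \<in> J" for i
      using measurable_component_singleton[OF that, of N] sN[of i] by (metis measurable_cong_sets)
    then show "(\<lambda>x. ennreal (b x)) \<in> borel_measurable (Pi\<^sub>M J N)"
      unfolding b_def by measurable
  qed
  also have "(\<integral>\<^sup>+x. (\<integral>\<^sup>+y. h x y \<partial>N l) \<partial>Pi\<^sub>M J N) = (\<integral>\<^sup>+x. ennreal (G (\<chi> i. x i)) \<partial>Pi\<^sub>M UNIV N)"
    unfolding h_def U by (rule N.product_nn_integral_insert[OF J mG[OF sN], symmetric])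
  also have "(\<integral>\<^sup>+x. ennreal (b x) \<partial>Pi\<^sub>M J N) \<le> ennreal (K * (3 / a) ^ (CARD('n) - 1))"
  proof -
    have mi: "(\<lambda>y. ennreal (exp (- (a * \<bar>y\<bar>)))) \<in> borel_measurable (N i)" for i
      using sN[of i] by measurable
    have "(\<integral>\<^sup>+x. ennreal (b x) \<partial>Pi\<^sub>M J N)
        = (\<integral>\<^sup>+x. ennreal K * (\<Prod>i\<in>J. ennreal (exp (- (a * \<bar>x i\<bar>)))) \<partial>Pi\<^sub>M J N)"
      using K by (intro nn_integral_cong) (simp add: b_def ennreal_mult prod_nonneg prod_ennreal)
    also have "\<dots> = ennreal K * (\<integral>\<^sup>+x. (\<Prod>i\<in>J. ennreal (exp (- (a * \<bar>x i\<bar>)))) \<partial>Pi\<^sub>M J N)"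
    proof (rule nn_integral_cmult)
      show "(\<lambda>x. \<Prod>i\<in>J. ennreal (exp (- (a * \<bar>x i\<bar>)))) \<in> borel_measurable (Pi\<^sub>M J N)"
        using measurable_compose[OF measurable_component_singleton[of _ J N] mi]
        by (intro borel_measurable_prod_ennreal) auto
    qed
    also have "\<dots> = ennreal K * (\<Prod>i\<in>J. \<integral>\<^sup>+y. ennreal (exp (- (a * \<bar>y\<bar>))) \<partial>N i)"
      using J mi by (subst N.product_nn_integral_prod) auto
    also have "\<dots> \<le> ennreal K * (\<Prod>i\<in>J. ennreal (3 / a))"
      by (intro mult_left_mono prod_mono_ennreal nn_integral_exp_abs_le[OF a N]) auto
    also have "\<dots> = ennreal (K * (3 / a) ^ (CARD('n) - 1))"
      using K a by (simp add: J_def Compl_eq_Diff_UNIV card_Diff_singleton ennreal_mult ennreal_power)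
    finally show ?thesis .
  qed
  finally show ?thesis by (simp add: add_left_mono)
qed

text \<open>Induction on the set \<open>S\<close> of coordinates already switched from
  \<open>M\<close> to \<open>N\<close>; the intermediate products mix both kinds of factors, and
  each switch costs \<open>E\<close>.\<close>

lemma nn_integral_PiM_telescope_le:
  fixes G :: "real^'n::finite \<Rightarrow> real" and M N :: "'n \<Rightarrow> real measure"
  assumes M: "\<And>i. M i \<in> {lborel, int_measure}" and N: "\<And>i. N i \<in> {lborel, int_measure}"
    and G: "G \<in> borel_measurable borel" and G0: "\<And>x. 0 \<le> G x"
    and qc: "\<And>x y t. 0 \<le> t \<Longrightarrow> t \<le> 1 \<Longrightarrow> min (G x) (G y) \<le> G ((1 - t) *\<^sub>R x + t *\<^sub>R y)"
    and a: "0 < a" "a \<le> 1" and K: "0 \<le> K"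
    and bound: "\<And>x. G x \<le> K * (\<Prod>i\<in>UNIV. exp (- (a * \<bar>x $ i\<bar>)))"
  shows "(\<integral>\<^sup>+x. ennreal (G (\<chi> i. x i)) \<partial>Pi\<^sub>M UNIV M)
    \<le> (\<integral>\<^sup>+x. ennreal (G (\<chi> i. x i)) \<partial>Pi\<^sub>M UNIV N) + ennreal (CARD('n) * (K * (3 / a) ^ (CARD('n) - 1)))"
proof -
  define E where "E = K * (3 / a) ^ (CARD('n) - 1)"
  have E: "0 \<le> E" using K a by (simp add: E_def)
  define I where "I M' = (\<integral>\<^sup>+x. ennreal (G (\<chi> i. x i)) \<partial>Pi\<^sub>M UNIV M')" for M'
  have "I M \<le> I (\<lambda>i. if i \<in> S then N i else M i) + ennreal (card S * E)" for S :: "'n set"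
  proof (induction rule: finite_induct[OF finite[of S]])
    case (2 l S)
    have "I (\<lambda>i. if i \<in> S then N i else M i) \<le> I (\<lambda>i. if i \<in> insert l S then N i else M i) + ennreal E"
      unfolding I_def E_def
      by (rule nn_integral_PiM_change_le[where l=l, OF _ _ _ G G0 qc a K bound]) (use M N in auto)
    then have "I M \<le> I (\<lambda>i. if i \<in> insert l S then N i else M i) + ennreal E + ennreal (card S * E)"
      using 2(3) by (meson add_right_mono order_trans)
    also have "ennreal (card (insert l S) * E) = ennreal E + ennreal (card S * E)"
      using 2 E by (simp add: algebra_simps flip: ennreal_plus)
    ultimately show ?case by (simp add: add.assoc)
  qed simp
  from this[of UNIV] show ?thesis by (simp add: I_def E_def)
qed

text \<open>Telescoping in both directions gives the two inequalities. The one that bounds the sum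
  by the integral also shows that the sum is finite.\<close>

lemma integral_minus_lattice_sum_le:
  fixes G :: "real^'n::finite \<Rightarrow> real"
  assumes G [measurable]: "G \<in> borel_measurable borel" and G0: "\<And>x. 0 \<le> G x"
    and qc: "\<And>x y t. 0 \<le> t \<Longrightarrow> t \<le> 1 \<Longrightarrow> min (G x) (G y) \<le> G ((1 - t) *\<^sub>R x + t *\<^sub>R y)"
    and a: "0 < a" "a \<le> 1" and K: "0 \<le> K"
    and bound: "\<And>x. G x \<le> K * (\<Prod>i\<in>UNIV. exp (- (a * \<bar>x $ i\<bar>)))"
    and int: "integrable lborel G"
  shows "integrable (count_space UNIV) (\<lambda>k. G (of_int_vec k))"
    and "\<bar>(LINT k|count_space UNIV. G (of_int_vec k)) - (LINT x|lborel. G x)\<bar>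
      \<le> CARD('n) * (K * (3 / a) ^ (CARD('n) - 1))"
proof -
  define E where "E = CARD('n) * (K * (3 / a) ^ (CARD('n) - 1))"
  have E: "0 \<le> E" using K a by (simp add: E_def)
  define S where "S = (\<integral>\<^sup>+k. ennreal (G (of_int_vec k)) \<partial>count_space UNIV)"
  define L where "L = (\<integral>\<^sup>+x. ennreal (G x) \<partial>lborel)"
  have S: "(\<integral>\<^sup>+x. ennreal (G (\<chi> i. x i)) \<partial>Pi\<^sub>M UNIV (\<lambda>_::'n. int_measure)) = S"
    unfolding PiM_int_measure S_def of_int_vec_def
    by (rule nn_integral_distr)
      (auto intro!: measurable_compose[OF measurable_vec_lambda_PiM] simp: space_PiM)
  have L: "(\<integral>\<^sup>+x. ennreal (G (\<chi> i. x i)) \<partial>Pi\<^sub>M UNIV (\<lambda>_::'n. lborel)) = L"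
    unfolding L_def by (subst lborel_vec_eq_distr, subst nn_integral_distr)
      (auto intro: measurable_vec_lambda_PiM)
  have SL: "S \<le> L + ennreal E" "L \<le> S + ennreal E"
    unfolding S[symmetric] L[symmetric] E_def
    by (rule nn_integral_PiM_telescope_le[OF _ _ G G0 qc a K bound]; simp)+
  have Lint: "L = ennreal (LINT x|lborel. G x)"
    unfolding L_def by (rule nn_integral_eq_integral[OF int]) (simp add: G0)
  then have "S < \<infinity>" using SL(1) by (metis ennreal_add_less_top ennreal_less_top infinity_ennreal_def order_le_less_trans)
  then show intS: "integrable (count_space UNIV) (\<lambda>k. G (of_int_vec k))"
    unfolding S_def by (intro integrableI_nonneg) (auto simp: G0)
  then have Sint: "S = ennreal (LINT k|count_space UNIV. G (of_int_vec k))"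
    unfolding S_def by (intro nn_integral_eq_integral) (auto simp: G0)
  have nn: "0 \<le> (LINT x|lborel. G x)" "0 \<le> (LINT k|count_space UNIV. G (of_int_vec k))"
    using G0 by (auto intro!: integral_nonneg)
  have "(LINT k|count_space UNIV. G (of_int_vec k)) \<le> (LINT x|lborel. G x) + E"
    "(LINT x|lborel. G x) \<le> (LINT k|count_space UNIV. G (of_int_vec k)) + E"
    using SL E nn unfolding Lint Sint by (simp_all flip: ennreal_plus)
  then show "\<bar>(LINT k|count_space UNIV. G (of_int_vec k)) - (LINT x|lborel. G x)\<bar>
      \<le> CARD('n) * (K * (3 / a) ^ (CARD('n) - 1))"
    unfolding E_def[symmetric] by linarith
qed

section \<open>Bounds on an isotropic log-concave density\<close>

lemma has_bochner_integral_lborel_affine: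
  fixes h :: "'a::euclidean_space \<Rightarrow> real"
  assumes "has_bochner_integral lborel h I" "c \<noteq> 0"
  shows "has_bochner_integral lborel (\<lambda>x. h (t + c *\<^sub>R x)) (I / \<bar>c\<bar> ^ DIM('a))"
proof -
  let ?T = "\<lambda>x::'a. t + c *\<^sub>R x"
  have [measurable]: "h \<in> borel_measurable borel"
    using assms(1) borel_measurable_has_bochner_integral by fastforce
  have dens: "lborel = density (distr lborel borel ?T) (\<lambda>_. ennreal (\<bar>c\<bar> ^ DIM('a)))"
    using lborel_affine[OF assms(2), of t] by (simp add: ennreal_power)
  have h: "integrable lborel h" "integral\<^sup>L lborel h = I"
    using assms(1) by (auto simp: has_bochner_integral_iff)
  have "integrable lborel (\<lambda>x. \<bar>c\<bar> ^ DIM('a) *\<^sub>R h (?T x))"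
    using h(1) by (subst (asm) dens) (simp add: integrable_density integrable_distr_eq del: integrable_mult_left_iff integrable_mult_right_iff)
  then have "integrable lborel (\<lambda>x. h (?T x))" using assms(2) by simp
  moreover have "I = \<bar>c\<bar> ^ DIM('a) * integral\<^sup>L lborel (\<lambda>x. h (?T x))"
    by (subst h(2)[symmetric], subst dens) (simp add: integral_density integral_distr)
  ultimately show ?thesis using assms(2) by (simp add: has_bochner_integral_iff)
qed

text \<open>The rows of the identity are replaced one at a time by vectors of \<open>K\<close>. As a
  function of row \<open>l\<close> the determinant is a functional \<open>v \<bullet> n\<close>; its
  value at the old unit row is the current determinant, so \<open>norm n\<close> is at least that
  large in absolute value. Width of \<open>K\<close> in direction \<open>n\<close> then yields a row
  for which the determinant shrinks at most by the factor \<open>c\<close>.\<close>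

lemma exists_rows_det_ge:
  fixes K :: "(real^'n::finite) set"
  assumes c: "0 < c" and wide: "\<And>n. n \<noteq> 0 \<Longrightarrow> \<exists>v\<in>K. c * norm n \<le> \<bar>v \<bullet> n\<bar>"
  shows "\<exists>A :: real^'n^'n. (\<forall>i. A $ i \<in> K) \<and> c ^ CARD('n) \<le> \<bar>det A\<bar>"
proof -
  have "\<exists>A :: real^'n^'n. (\<forall>i\<in>S. A $ i \<in> K) \<and> (\<forall>i. i \<notin> S \<longrightarrow> A $ i = axis i 1)
      \<and> c ^ card S \<le> \<bar>det A\<bar>" for S :: "'n set"
  proof (induction rule: finite_induct[OF finite[of S]])
    case 1
    have "(\<chi> i. axis i 1) = (mat 1 :: real^'n^'n)"
      by (auto simp: mat_def axis_def vec_eq_iff)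
    then have "det ((\<chi> i. axis i 1) :: real^'n^'n) = 1" by simp
    then show ?case by (intro exI[of _ "\<chi> i. axis i 1"]) simp
  next
    case (2 l S)
    then obtain A :: "real^'n^'n" where A: "\<And>i. i \<in> S \<Longrightarrow> A $ i \<in> K"
        "\<And>i. i \<notin> S \<Longrightarrow> A $ i = axis i 1" "c ^ card S \<le> \<bar>det A\<bar>" by blast
    define \<phi> where "\<phi> v = det (\<chi> i. if i = l then v else A $ i)" for v
    have "linear \<phi>"
    proof (rule linearI)
      show "\<phi> (x + y) = \<phi> x + \<phi> y" for x y
        unfolding \<phi>_def by (rule det_row_add)
      show "\<phi> (r *\<^sub>R x) = r *\<^sub>R \<phi> x" for r x
        unfolding \<phi>_def scalar_mult_eq_scaleR[symmetric] real_scaleR_def by (rule det_row_mul)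
    qed
    \<comment> \<open>The vector representing \<open>\<phi>\<close>; its entries are the cofactors
      of row \<open>l\<close>.\<close>
    define n where "n = adjoint \<phi> 1"
    have \<phi>: "\<phi> v = v \<bullet> n" for v
      using adjoint_works[OF \<open>linear \<phi>\<close>, of v 1] by (simp add: n_def)
    have "A = (\<chi> i. if i = l then A $ l else A $ i)" by (simp add: vec_eq_iff)
    then have "det A = axis l 1 \<bullet> n"
      using 2 A(2)[of l] by (metis \<phi> \<phi>_def)
    then have "\<bar>det A\<bar> \<le> norm n"
      by (simp add: inner_axis' component_le_norm_cart)
    moreover have "0 < c ^ card S" using c by simp
    ultimately have n: "n \<noteq> 0" "c ^ card S \<le> norm n" using A(3) by auto
    obtain v where v: "v \<in> K" "c * norm n \<le> \<bar>v \<bullet> n\<bar>" using wide[OF n(1)] by blast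
    have "c ^ card (insert l S) = c * c ^ card S" using 2 by simp
    also have "\<dots> \<le> c * norm n" using n c by simp
    also have "\<dots> \<le> \<bar>\<phi> v\<bar>" using v by (simp add: \<phi>)
    finally show ?case
      using v A unfolding \<phi>_def by (intro exI[of _ "\<chi> i. if i = l then v else A $ i"]) auto
  qed
  from this[of UNIV] show ?thesis by auto
qed

lemma has_bochner_integral_le:
  fixes g h :: "'a \<Rightarrow> real"
  assumes "has_bochner_integral M g a" "has_bochner_integral M h b" "\<And>x. g x \<le> h x"
  shows "a \<le> b"
  using assms by (auto simp: has_bochner_integral_iff intro: integral_mono)

text \<open>The library states the volume formula for linear images only for index types of class
  \<open>wellorder\<close>; its only use there is to compute the determinant of a shear, which is a row
  operation on the identity.\<close>

lemma lmeasurable_linear_image_det: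
  fixes g :: "real^'n::finite \<Rightarrow> real^'n" and S :: "(real^'n) set"
  assumes "linear g" "S \<in> lmeasurable"
  shows "g ` S \<in> lmeasurable \<and> measure lebesgue (g ` S) = \<bar>det (matrix g)\<bar> * measure lebesgue S"
proof -
  define P where "P = (\<lambda>g :: real^'n \<Rightarrow> real^'n. \<forall>S \<in> lmeasurable.
    g ` S \<in> lmeasurable \<and> measure lebesgue (g ` S) = \<bar>det (matrix g)\<bar> * measure lebesgue S)"
  have suff: "P h" if lin: "linear h" and det: "\<bar>det (matrix h)\<bar> = 1"
      and box: "\<And>a b. cbox a b \<noteq> {} \<Longrightarrow> measure lebesgue (h ` cbox a b) = measure lebesgue (cbox a b)" for h
  proof -
    have box1: "measure lebesgue (h ` cbox a b) = 1 * measure lebesgue (cbox a b)" for a b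
      using box[of a b] by (cases "cbox a b = {}") auto
    then show ?thesis
      unfolding P_def det using measure_linear_sufficient[OF lin _ box1] by (metis mult_1)
  qed
  have "P g"
  \<comment> \<open>Every linear map is composed of maps with a vanishing coordinate, diagonal maps,
    transpositions of coordinates and shears.\<close>
  proof (rule induct_linear_elementary[OF assms(1)])
    fix h k :: "real^'n \<Rightarrow> real^'n"
    assume hk: "linear h" "linear k" "P h" "P k"
    show "P (h \<circ> k)"
      using hk(3,4) unfolding P_def image_comp[symmetric] matrix_compose[OF hk(2,1)] det_mul abs_mult
      by simp
  next
    fix h :: "real^'n \<Rightarrow> real^'n" and i
    assume h: "linear h" "\<And>x. h x $ i = 0"
    then have "\<not> inj h"
      by (metis linear_injective_imp_surjective one_neq_zero surjE vec_component)
    then have "det (matrix h) = 0" "negligible (h ` S)" for S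
      using det_nz_iff_inj[OF h(1)] negligible_linear_singular_image[OF h(1)] by auto
    then show "P h"
      unfolding P_def by (simp add: negligible_iff_measure)
  next
    fix c :: "'n \<Rightarrow> real"
    have "det (matrix (\<lambda>x. \<chi> i. c i * x $ i)) = prod c UNIV"
      by (subst det_diagonal) (auto simp: matrix_def axis_def)
    then show "P (\<lambda>x. \<chi> i. c i * x $ i)"
      unfolding P_def by (simp add: measurable_stretch measure_stretch)
  next
    fix m n :: 'n
    assume "m \<noteq> n"
    let ?\<tau> = "Transposition.transpose m n"
    let ?h = "\<lambda>x :: real^'n. \<chi> i. x $ ?\<tau> i"
    show "P ?h"
    proof (rule suff)
      show "linear ?h" by (rule linearI) (simp_all add: vec_eq_iff)
      have "matrix ?h = (\<chi> i. (mat 1 :: real^'n^'n) $ ?\<tau> i)"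
        by (auto simp: matrix_def mat_def axis_def vec_eq_iff)
      then show "\<bar>det (matrix ?h)\<bar> = 1"
        using det_permute_rows[of ?\<tau> "mat 1 :: real^'n^'n"]
        by (simp add: permutes_swap_id sign_swap_id)
      fix a b :: "real^'n" assume ne: "cbox a b \<noteq> {}"
      have eq: "?h ` cbox a b = cbox (?h a) (?h b)"
      proof (intro equalityI subsetI)
        fix y assume "y \<in> cbox (?h a) (?h b)"
        then have "?h y \<in> cbox a b"
          by (simp add: mem_box_cart) (metis transpose_involutory)
        moreover have "y = ?h (?h y)" by (simp add: vec_eq_iff)
        ultimately show "y \<in> ?h ` cbox a b" by blast
      qed (auto simp: mem_box_cart)
      have ne2: "cbox (?h a) (?h b) \<noteq> {}" using ne unfolding eq[symmetric] by blast
      have "(\<Prod>i\<in>UNIV. b $ ?\<tau> i - a $ ?\<tau> i) = (\<Prod>i\<in>UNIV. b $ i - a $ i)"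
        by (rule prod.reindex_bij_betw) (simp add: bij_swap_iff)
      then show "measure lebesgue (?h ` cbox a b) = measure lebesgue (cbox a b)"
        unfolding eq using ne ne2 by (simp add: content_cbox_cart)
    qed
  next
    fix m n :: 'n
    assume mn: "m \<noteq> n"
    let ?h = "\<lambda>x :: real^'n. \<chi> i. if i = m then x $ m + x $ n else x $ i"
    show "P ?h"
    proof (rule suff)
      show lin: "linear ?h" by (rule linearI) (auto simp: vec_eq_iff algebra_simps)
      have "matrix ?h = (\<chi> k. if k = m then row m (mat 1) + 1 *s row n (mat 1) else row k (mat 1))"
        by (auto simp: matrix_def mat_def axis_def row_def vec_eq_iff)
      then show "\<bar>det (matrix ?h)\<bar> = 1"
        by (simp add: det_row_operation[OF mn])
      fix a b :: "real^'n" assume ne: "cbox a b \<noteq> {}"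
      \<comment> \<open>Translation by \<open>v\<close> moves the lower bound of coordinate
        \<open>n\<close> to 0, as \<open>measure_shear_interval\<close> requires it to be
        nonnegative.\<close>
      define v where "v = axis n (a $ n)"
      have box: "cbox a b = (+) v ` cbox (a - v) (b - v)"
        by (simp flip: cbox_translation)
      then have ne': "cbox (a - v) (b - v) \<noteq> {}" using ne by blast
      have "?h ` cbox a b = (+) (?h v) ` ?h ` cbox (a - v) (b - v)"
        unfolding box image_image linear_add[OF lin] ..
      then have "measure lebesgue (?h ` cbox a b) = measure lebesgue (?h ` cbox (a - v) (b - v))"
        by (simp only: measure_translation)
      also have "\<dots> = measure lebesgue (cbox (a - v) (b - v))"
        by (rule measure_shear_interval[OF mn ne']) (simp add: v_def)
      also have "\<dots> = measure lebesgue (cbox a b)"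
        unfolding box by (simp only: measure_translation)
      finally show "measure lebesgue (?h ` cbox a b) = measure lebesgue (cbox a b)" .
    qed
  qed
  then show ?thesis using assms(2) by (simp add: P_def)
qed

text \<open>\<open>transpose A *v s\<close> combines the rows of \<open>A\<close> with coefficients
  \<open>s\<close>, so the image is the parallelepiped spanned by the rows of \<open>A\<close>
  scaled by \<open>r\<close>.\<close>

lemma measure_cube_image:
  fixes A :: "real^'n::finite^'n"
  assumes "0 \<le> r"
  shows "measure lborel ((\<lambda>s. transpose A *v s) ` cbox 0 (\<chi> i. r)) = \<bar>det A\<bar> * r ^ CARD('n)"
proof -
  have lin: "linear (\<lambda>s. transpose A *v s)" by (rule matrix_vector_mul_linear)
  have "matrix (\<lambda>s. transpose A *v s) = transpose A"
    by (rule matrix_of_matrix_vector_mul)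
  moreover have "measure lebesgue (cbox 0 (\<chi> i. r) :: (real^'n) set) = r ^ CARD('n)"
    using assms by (simp add: content_cbox_if_cart interval_eq_empty_cart)
  ultimately have "measure lebesgue ((\<lambda>s. transpose A *v s) ` cbox 0 (\<chi> i. r)) = \<bar>det A\<bar> * r ^ CARD('n)"
    using lmeasurable_linear_image_det[OF lin] by simp
  moreover have "compact ((\<lambda>s. transpose A *v s) ` cbox 0 (\<chi> i. r))"
    by (intro compact_continuous_image linear_continuous_on lin compact_cbox)
      (use lin in \<open>simp add: linear_conv_bounded_linear\<close>)
  ultimately show ?thesis by (simp add: borel_compact)
qed

section \<open>Log-concave densities: moments, superlevel sets, upper bound and decay\<close>

lemma min_le_powr_mult_powr:
  fixes a b t :: real
  assumes "0 \<le> a" "0 \<le> b" "0 < t" "t < 1"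
  shows "min a b \<le> a powr (1 - t) * b powr t"
proof -
  have "min a b = min a b powr (1 - t) * min a b powr t"
    using assms by (simp flip: powr_add)
  also have "\<dots> \<le> a powr (1 - t) * b powr t"
    using assms by (intro mult_mono powr_mono2) auto
  finally show ?thesis .
qed

text \<open>Log-concavity appears in multiplicative form instead of through a potential. Since
  \<open>0 powr t = 0\<close>, the inequality is trivial where one of the two values vanishes.
  Covariances are plain second moments because the mean is 0.\<close>

locale isotropic_log_concave =
  fixes f :: "real^'n::finite \<Rightarrow> real" and \<sigma> :: real
  assumes \<sigma>: "0 < \<sigma>" and nonneg: "\<And>x. 0 \<le> f x"
    and lc: "\<And>t x y. 0 < t \<Longrightarrow> t < 1 \<Longrightarrow> f x powr (1 - t) * f y powr t \<le> f ((1 - t) *\<^sub>R x + t *\<^sub>R y)"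
    and total: "has_bochner_integral lborel f 1"
    and mean: "has_bochner_integral lborel (\<lambda>x. f x *\<^sub>R x) 0"
    and second_moment:
      "\<And>i j. has_bochner_integral lborel (\<lambda>x. f x * (x $ i * x $ j)) (if i = j then \<sigma>\<^sup>2 else 0)"
begin

lemma borel_measurable_density [measurable]: "f \<in> borel_measurable borel"
  using total borel_measurable_has_bochner_integral by fastforce

lemma midpoint: "f x * f y \<le> (f ((1/2) *\<^sub>R x + (1/2) *\<^sub>R y))\<^sup>2"
proof -
  have "f x powr (1/2) * f y powr (1/2) \<le> f ((1/2) *\<^sub>R x + (1/2) *\<^sub>R y)"
    using lc[of "1/2" x y] by simp
  then have "(f x powr (1/2) * f y powr (1/2))\<^sup>2 \<le> (f ((1/2) *\<^sub>R x + (1/2) *\<^sub>R y))\<^sup>2"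
    by (intro power_mono) auto
  then show ?thesis using nonneg by (simp add: powr_half_sqrt power_mult_distrib)
qed

text \<open>Isotropy turns the quadratic form of the second moments into a multiple of the squared
  norm. In the expansion about \<open>p\<close> the cross term vanishes by centering.\<close>

lemma moment_inner:
  "has_bochner_integral lborel (\<lambda>x. f x * ((x - p) \<bullet> n)\<^sup>2) (\<sigma>\<^sup>2 * (norm n)\<^sup>2 + (p \<bullet> n)\<^sup>2)"
proof -
  have "has_bochner_integral lborel (\<lambda>x. \<Sum>i\<in>UNIV. \<Sum>j\<in>UNIV. (n $ i * n $ j) * (f x * (x $ i * x $ j)))
      (\<Sum>i\<in>UNIV. \<Sum>j\<in>UNIV. (n $ i * n $ j) * (if i = j then \<sigma>\<^sup>2 else 0))"
    by (intro has_bochner_integral_sum has_bochner_integral_mult_right second_moment)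
  also have "(\<Sum>i\<in>UNIV. \<Sum>j\<in>UNIV. (n $ i * n $ j) * (if i = j then \<sigma>\<^sup>2 else 0)) = \<sigma>\<^sup>2 * (norm n)\<^sup>2"
    by (simp add: power2_norm_eq_inner inner_vec_def sum_distrib_left mult_ac if_distrib cong: if_cong)
  also have "(\<lambda>x. \<Sum>i\<in>UNIV. \<Sum>j\<in>UNIV. (n $ i * n $ j) * (f x * (x $ i * x $ j))) = (\<lambda>x. f x * (x \<bullet> n)\<^sup>2)"
    by (simp add: fun_eq_iff inner_vec_def power2_eq_square sum_product sum_distrib_left mult_ac)
  finally have 2: "has_bochner_integral lborel (\<lambda>x. f x * (x \<bullet> n)\<^sup>2) (\<sigma>\<^sup>2 * (norm n)\<^sup>2)" .
  have "has_bochner_integral lborel (\<lambda>x. (f x *\<^sub>R x) \<bullet> n) (0 \<bullet> n)"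
    by (rule has_bochner_integral_inner_left) (rule mean)
  then have 1: "has_bochner_integral lborel (\<lambda>x. f x * (x \<bullet> n)) 0" by simp
  have "has_bochner_integral lborel
      (\<lambda>x. f x * (x \<bullet> n)\<^sup>2 + (- 2 * (p \<bullet> n)) * (f x * (x \<bullet> n)) + (p \<bullet> n)\<^sup>2 * f x)
      (\<sigma>\<^sup>2 * (norm n)\<^sup>2 + (- 2 * (p \<bullet> n)) * 0 + (p \<bullet> n)\<^sup>2 * 1)"
    by (intro has_bochner_integral_add has_bochner_integral_mult_right 1 2 total)
  moreover have "f x * (x \<bullet> n)\<^sup>2 + (- 2 * (p \<bullet> n)) * (f x * (x \<bullet> n)) + (p \<bullet> n)\<^sup>2 * f x
      = f x * ((x - p) \<bullet> n)\<^sup>2" for x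
    by (simp add: inner_diff_left power2_eq_square algebra_simps)
  ultimately show ?thesis by simp
qed

lemma moment_norm:
  "has_bochner_integral lborel (\<lambda>x. f x * (norm (x - p))\<^sup>2) (CARD('n) * \<sigma>\<^sup>2 + (norm p)\<^sup>2)"
proof -
  have eq: "(norm y)\<^sup>2 = (\<Sum>i\<in>UNIV. (y \<bullet> axis i 1)\<^sup>2)" for y :: "real^'n"
    unfolding power2_norm_eq_inner by (simp add: inner_axis) (simp add: inner_vec_def power2_eq_square)
  have "has_bochner_integral lborel (\<lambda>x. \<Sum>i\<in>UNIV. f x * ((x - p) \<bullet> axis i 1)\<^sup>2)
      (\<Sum>i\<in>UNIV. \<sigma>\<^sup>2 * (norm (axis i 1 :: real^'n))\<^sup>2 + (p \<bullet> axis i 1)\<^sup>2)"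
    by (intro has_bochner_integral_sum moment_inner)
  then show ?thesis by (simp add: eq[of "_ - p"] eq[of p] sum_distrib_left sum.distrib)
qed

text \<open>Doubling about \<open>p\<close> divides the second moment by \<open>2 ^ (CARD('n) + 2)\<close>, while log-concavity makes
  the doubled density much smaller than the original one outside the superlevel set.\<close>

lemma superlevel_wide:
  assumes p: "0 < f p" and n: "n \<noteq> 0"
  shows "\<exists>v. f p / 2 ^ (CARD('n) + 3) \<le> f (p + v) \<and> \<sigma> / 3 * norm n \<le> \<bar>v \<bullet> n\<bar>"
proof (rule ccontr)
  define d where "d = CARD('n)"
  \<comment> \<open>Half of the factor \<open>1 / 2 ^ (d + 2)\<close> produced by doubling, so that
    \<open>\<theta> * I\<close> absorbs only half of the doubled moment.\<close>
  define \<theta> :: real where "\<theta> = 1 / 2 ^ (d + 3)"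
  define w where "w = \<sigma> / 3 * norm n"
  define I where "I = \<sigma>\<^sup>2 * (norm n)\<^sup>2 + (p \<bullet> n)\<^sup>2"
  have w: "0 \<le> w" using \<sigma> by (simp add: w_def)
  assume "\<not> ?thesis"
  then have narrow: "\<bar>v \<bullet> n\<bar> < w" if "\<theta> * f p \<le> f (p + v)" for v
    using that unfolding \<theta>_def w_def d_def by (metis mult.left_neutral not_le times_divide_eq_left)
  \<comment> \<open>If \<open>p + v\<close> lies in the superlevel set, the square is below
    \<open>w\<^sup>2\<close>. Otherwise \<open>p + v\<close> is the midpoint of \<open>p\<close> and
    \<open>p + 2 *\<^sub>R v\<close>, and log-concavity gives
    \<open>f (p + 2 *\<^sub>R v) \<le> \<theta> * f (p + v)\<close>.\<close>
  have pointwise: "f (p + 2 *\<^sub>R v) * (v \<bullet> n)\<^sup>2 \<le> w\<^sup>2 * f (p + 2 *\<^sub>R v) + \<theta> * (f (p + 1 *\<^sub>R v) * (v \<bullet> n)\<^sup>2)" for v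
  proof (cases "\<theta> * f p \<le> f (p + v)")
    case True
    then have "\<bar>v \<bullet> n\<bar>\<^sup>2 \<le> w\<^sup>2" by (intro power_mono) (use narrow[of v] in auto)
    then have "f (p + 2 *\<^sub>R v) * (v \<bullet> n)\<^sup>2 \<le> f (p + 2 *\<^sub>R v) * w\<^sup>2"
      by (intro mult_left_mono nonneg) simp
    moreover have "0 \<le> \<theta> * (f (p + 1 *\<^sub>R v) * (v \<bullet> n)\<^sup>2)" by (simp add: \<theta>_def nonneg)
    ultimately show ?thesis by (simp add: mult.commute)
  next
    case False
    have mid: "(1/2) *\<^sub>R p + (1/2) *\<^sub>R (p + 2 *\<^sub>R v) = p + v"
      by (simp add: scaleR_add_right flip: scaleR_add_left add.assoc)
    have "f p * f (p + 2 *\<^sub>R v) \<le> f (p + v) * f (p + v)"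
      using midpoint[of p "p + 2 *\<^sub>R v"] unfolding mid by (simp add: power2_eq_square)
    also have "\<dots> \<le> (\<theta> * f p) * f (p + v)"
      using False by (intro mult_right_mono nonneg) auto
    finally have "f (p + 2 *\<^sub>R v) \<le> \<theta> * f (p + v)" using p by (simp add: mult_ac)
    then have "f (p + 2 *\<^sub>R v) * (v \<bullet> n)\<^sup>2 \<le> \<theta> * f (p + v) * (v \<bullet> n)\<^sup>2"
      by (rule mult_right_mono) simp
    moreover have "0 \<le> w\<^sup>2 * f (p + 2 *\<^sub>R v)" by (simp add: nonneg)
    ultimately show ?thesis by (simp add: mult.assoc)
  qed
  have "has_bochner_integral lborel (\<lambda>v. f (p + 2 *\<^sub>R v) * ((p + 2 *\<^sub>R v - p) \<bullet> n)\<^sup>2) (I / \<bar>2\<bar> ^ DIM(real^'n))"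
    using has_bochner_integral_lborel_affine[OF moment_inner[of p n], of 2 p] by (simp add: I_def)
  from has_bochner_integral_mult_right[OF this, of "1/4"]
  have 1: "has_bochner_integral lborel (\<lambda>v. f (p + 2 *\<^sub>R v) * (v \<bullet> n)\<^sup>2) (I / 2 ^ (d + 2))"
    by (simp add: d_def power_mult_distrib mult_ac power_add)
  have 2: "has_bochner_integral lborel (\<lambda>v. f (p + 2 *\<^sub>R v)) (1 / 2 ^ d)"
    using has_bochner_integral_lborel_affine[OF total, of 2 p] by (simp add: d_def)
  have 3: "has_bochner_integral lborel (\<lambda>v. f (p + 1 *\<^sub>R v) * (v \<bullet> n)\<^sup>2) I"
    using has_bochner_integral_lborel_affine[OF moment_inner[of p n], of 1 p] by (simp add: I_def)
  have "I / 2 ^ (d + 2) \<le> w\<^sup>2 * (1 / 2 ^ d) + \<theta> * I"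
  proof (rule has_bochner_integral_le[OF 1])
    show "has_bochner_integral lborel
        (\<lambda>v. w\<^sup>2 * f (p + 2 *\<^sub>R v) + \<theta> * (f (p + 1 *\<^sub>R v) * (v \<bullet> n)\<^sup>2)) (w\<^sup>2 * (1 / 2 ^ d) + \<theta> * I)"
      by (intro has_bochner_integral_add has_bochner_integral_mult_right 2 3)
  qed (rule pointwise)
  \<comment> \<open>The divisor 3 in \<open>w\<close> is chosen because its square exceeds this
    8.\<close>
  then have "I \<le> 8 * w\<^sup>2" by (simp add: \<theta>_def power_add field_simps)
  moreover have "9 * w\<^sup>2 \<le> I" by (simp add: w_def I_def power_mult_distrib power_divide)
  moreover have "0 < w" using \<sigma> n by (simp add: w_def)
  ultimately show False by (smt (verit) zero_less_power2)
qed

lemma quasiconcave: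
  assumes "0 \<le> t" "t \<le> 1"
  shows "min (f x) (f y) \<le> f ((1 - t) *\<^sub>R x + t *\<^sub>R y)"
proof (cases "t = 0 \<or> t = 1")
  case False
  then have t: "0 < t" "t < 1" using assms by auto
  have "min (f x) (f y) \<le> f x powr (1 - t) * f y powr t"
    by (rule min_le_powr_mult_powr[OF nonneg nonneg t])
  also have "\<dots> \<le> f ((1 - t) *\<^sub>R x + t *\<^sub>R y)" by (rule lc[OF t])
  finally show ?thesis .
qed auto

text \<open>The superlevel set of \<open>q\<close> about \<open>p\<close> is convex, contains 0 and
  is wide in every direction, so it contains a parallelepiped \<open>T\<close> of volume at least
  \<open>(\<sigma> / (3 * d)) ^ d\<close>. The total mass 1 is at least \<open>q\<close> times this
  volume.\<close>

lemma density_le: "f p \<le> 2 ^ (CARD('n) + 3) * (3 * CARD('n) / \<sigma>) ^ CARD('n)"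
proof (cases "f p = 0")
  case False
  then have p: "0 < f p" using nonneg[of p] by simp
  define d where "d = CARD('n)"
  have d: "0 < d" by (simp add: d_def)
  define q where "q = f p / 2 ^ (d + 3)"
  have q: "0 < q" "q \<le> f p" using p by (simp_all add: q_def divide_le_eq)
  define K where "K = {v. q \<le> f (p + v)}"
  have conv: "convex K"
  proof (rule convexI)
    fix x y and u v :: real
    assume xy: "x \<in> K" "y \<in> K" and uv: "0 \<le> u" "0 \<le> v" "u + v = 1"
    have u: "u = 1 - v" using uv by simp
    have "p + (u *\<^sub>R x + v *\<^sub>R y) = (1 - v) *\<^sub>R (p + x) + v *\<^sub>R (p + y)"
      unfolding u by (simp add: algebra_simps)
    then show "u *\<^sub>R x + v *\<^sub>R y \<in> K"
      using quasiconcave[of v "p + x" "p + y"] xy uv by (simp add: K_def)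
  qed
  obtain A :: "real^'n^'n" where A: "\<And>i. A $ i \<in> K" "(\<sigma> / 3) ^ d \<le> \<bar>det A\<bar>"
    using exists_rows_det_ge[of "\<sigma> / 3" K] superlevel_wide[OF p] \<sigma>
    unfolding K_def q_def d_def by auto
  \<comment> \<open>With side \<open>1 / d\<close> the coefficients sum to at most 1, which keeps
    \<open>T\<close> in the convex hull of 0 and the rows of \<open>A\<close>.\<close>
  define T where "T = (\<lambda>s. transpose A *v s) ` cbox 0 (\<chi> i. 1 / real d)"
  have "T \<subseteq> K"
  proof
    fix x assume "x \<in> T"
    then obtain s where s: "x = transpose A *v s" "\<And>i. 0 \<le> s $ i" "\<And>i. s $ i \<le> 1 / real d"
      by (auto simp: T_def mem_box_cart)
    have "x = (\<Sum>i\<in>UNIV. s $ i *\<^sub>R A $ i)"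
      by (simp add: s(1) vec_eq_iff matrix_vector_mult_def transpose_def mult.commute)
    also have "\<dots> = (\<Sum>i\<in>UNIV. s $ i *\<^sub>R A $ i) + (1 - (\<Sum>i\<in>UNIV. s $ i)) *\<^sub>R 0" by simp
    also have "\<dots> \<in> K"
    proof -
      have z: "0 \<in> K" using q by (simp add: K_def)
      have "(\<Sum>i\<in>UNIV. s $ i) \<le> (\<Sum>i\<in>(UNIV::'n set). 1 / real d)" by (rule sum_mono) (rule s)
      then have "(\<Sum>i\<in>UNIV. s $ i) \<le> 1" using d by (simp add: d_def)
      \<comment> \<open>The extra index \<open>None\<close> carries the remaining weight, placed at
        the point 0, so that the combination becomes convex.\<close>
      define g :: "'n option \<Rightarrow> real" where "g o' = (case o' of None \<Rightarrow> 1 - (\<Sum>i\<in>UNIV. s $ i) | Some i \<Rightarrow> s $ i)" for o'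
      define P where "P o' = (case o' of None \<Rightarrow> 0 | Some i \<Rightarrow> A $ i)" for o'
      have "(\<Sum>o'\<in>UNIV. g o' *\<^sub>R P o') \<in> K"
      proof (rule convex_sum[OF _ conv])
        show "sum g UNIV = 1" by (simp add: g_def UNIV_option_conv sum.reindex)
      qed (use z A s \<open>_ \<le> 1\<close> in \<open>auto simp: g_def P_def split: option.split\<close>)
      then show ?thesis by (simp add: g_def P_def UNIV_option_conv sum.reindex)
    qed
    finally show "x \<in> K" .
  qed
  have "compact T" unfolding T_def
    by (intro compact_continuous_image compact_cbox linear_continuous_on)
      (simp flip: linear_conv_bounded_linear)
  then have fin: "T \<in> sets lborel" "emeasure lborel T < \<infinity>"
    using emeasure_bounded_finite[OF compact_imp_bounded] by (auto simp: borel_compact)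
  have "q * measure lborel T \<le> 1 / \<bar>1\<bar> ^ DIM(real^'n)"
  proof (rule has_bochner_integral_le)
    show "has_bochner_integral lborel (\<lambda>v. q * indicator T v) (q * measure lborel T)"
      by (intro has_bochner_integral_mult_right has_bochner_integral_real_indicator fin)
    show "has_bochner_integral lborel (\<lambda>v. f (p + 1 *\<^sub>R v)) (1 / \<bar>1\<bar> ^ DIM(real^'n))"
      by (rule has_bochner_integral_lborel_affine[OF total]) simp
    show "q * indicator T v \<le> f (p + 1 *\<^sub>R v)" for v
      using \<open>T \<subseteq> K\<close> nonneg by (auto simp: indicator_def K_def)
  qed
  moreover have "measure lborel T = \<bar>det A\<bar> * (1 / real d) ^ d"
    unfolding T_def d_def by (rule measure_cube_image) simp
  moreover have "q * ((\<sigma> / 3) ^ d * (1 / real d) ^ d) \<le> q * (\<bar>det A\<bar> * (1 / real d) ^ d)"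
    using q A by (intro mult_left_mono mult_right_mono) auto
  ultimately have "q * ((\<sigma> / 3) ^ d * (1 / real d) ^ d) \<le> 1" by simp
  then have "q \<le> (3 * d / \<sigma>) ^ d"
    using \<sigma> d by (simp add: power_divide power_mult_distrib field_simps)
  then have "f p \<le> 2 ^ (d + 3) * (3 * d / \<sigma>) ^ d"
    by (simp add: q_def divide_le_eq mult.commute)
  then show ?thesis by (simp add: d_def)
qed (use \<sigma> in simp)

text \<open>The supremum is finite by \<open>density_le\<close> and positive; a value above its
  \<open>1 / e\<close> part exists whether or not it is attained.\<close>

lemma exists_almost_max: "\<exists>p. 0 < f p \<and> (\<forall>x. f x \<le> exp 1 * f p)"
proof -
  have bdd: "bdd_above (range f)" by (rule bdd_aboveI2) (rule density_le)
  have "\<exists>x. f x \<noteq> 0"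
  proof (rule ccontr)
    assume "\<not> ?thesis"
    then have "has_bochner_integral lborel (\<lambda>x::real^'n. 0::real) 1" using total by (simp add: fun_eq_iff[symmetric])
    then show False by (simp add: has_bochner_integral_iff)
  qed
  then obtain z where z: "0 < f z" using nonneg by (metis order_le_less)
  define s where "s = Sup (range f)"
  have le: "f x \<le> s" for x unfolding s_def by (rule cSup_upper[OF _ bdd]) simp
  with z have s: "0 < s" by (meson less_le_trans)
  then have "s / exp 1 < s" by (simp add: divide_less_eq)
  then obtain p where p: "s / exp 1 < f p"
    unfolding s_def by (subst (asm) less_cSup_iff[OF _ bdd]) auto
  have "0 < f p" using p s by (meson divide_pos_pos exp_gt_zero less_trans)
  moreover have "f x \<le> exp 1 * f p" for x
    using le[of x] p by (simp add: divide_less_eq mult.commute)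
  ultimately show ?thesis by blast
qed

text \<open>Integrate \<open>f z * (norm z)\<^sup>2\<close> over the midpoints \<open>z\<close> of \<open>x\<close> and \<open>y\<close>, using
  \<open>f z \<ge> sqrt (f x * f y) \<ge> sqrt (f x / M) * f y\<close>.\<close>

lemma density_far_le:
  assumes M: "0 < M" "\<And>y. f y \<le> M" and x: "2 ^ (CARD('n) + 2) * CARD('n) * \<sigma> \<le> norm x"
  shows "f x \<le> M * exp (- 2)"
proof -
  define d where "d = real CARD('n)"
  have d: "1 \<le> d" by (simp add: d_def Suc_leI)
  define r where "r = sqrt (f x / M)"
  have r: "0 \<le> r" "r\<^sup>2 = f x / M" using nonneg M by (simp_all add: r_def)
  define D where "D = d * \<sigma>\<^sup>2"
  have D: "0 < D" using d \<sigma> by (simp add: D_def)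
  \<comment> \<open>Twice the midpoint is \<open>y - (- x)\<close>, so the left side comes from the
    second moment about \<open>- x\<close>, with \<open>1/4\<close> from halving. The divisor on the
    right is the Jacobian of \<open>y \<mapsto> z\<close>.\<close>
  have "1/4 * r * (D + (norm (- x))\<^sup>2) \<le> D / \<bar>1/2\<bar> ^ DIM(real^'n)"
  proof (rule has_bochner_integral_le)
    show "has_bochner_integral lborel (\<lambda>y. 1/4 * r * (f y * (norm (y - (- x)))\<^sup>2)) (1/4 * r * (D + (norm (- x))\<^sup>2))"
      unfolding D_def d_def by (intro has_bochner_integral_mult_right moment_norm)
    have "has_bochner_integral lborel (\<lambda>x. f x * (norm (x - 0))\<^sup>2) (CARD('n) * \<sigma>\<^sup>2 + (norm (0::real^'n))\<^sup>2)"
      by (rule moment_norm)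
    then have "has_bochner_integral lborel (\<lambda>x. f x * (norm x)\<^sup>2) D" by (simp add: D_def d_def)
    then show "has_bochner_integral lborel (\<lambda>y. f ((1/2) *\<^sub>R x + (1/2) *\<^sub>R y) * (norm ((1/2) *\<^sub>R x + (1/2) *\<^sub>R y))\<^sup>2)
        (D / \<bar>1/2\<bar> ^ DIM(real^'n))"
      by (rule has_bochner_integral_lborel_affine) simp
    fix y
    define z where "z = (1/2) *\<^sub>R x + (1/2) *\<^sub>R y"
    have "(r * f y)\<^sup>2 = f x * f y * (f y / M)"
      unfolding power_mult_distrib r(2) by (simp add: power2_eq_square)
    also have "\<dots> \<le> f x * f y * 1"
      using M nonneg by (intro mult_left_mono mult_nonneg_nonneg) (auto simp: divide_le_eq)
    also have "\<dots> \<le> (f z)\<^sup>2" using midpoint[of x y] by (simp add: z_def)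
    finally have "r * f y \<le> f z" by (rule power2_le_imp_le) (rule nonneg)
    then have "r * f y * (norm z)\<^sup>2 \<le> f z * (norm z)\<^sup>2" by (rule mult_right_mono) simp
    moreover have "norm (y - (- x)) = 2 * norm z"
    proof -
      have "y - (- x) = 2 *\<^sub>R z" by (simp add: z_def scaleR_add_right add.commute)
      then show ?thesis by simp
    qed
    ultimately show "1/4 * r * (f y * (norm (y - (- x)))\<^sup>2)
        \<le> f ((1/2) *\<^sub>R x + (1/2) *\<^sub>R y) * (norm ((1/2) *\<^sub>R x + (1/2) *\<^sub>R y))\<^sup>2"
      unfolding z_def[symmetric] by (simp add: power_mult_distrib mult_ac)
  qed
  then have "r * (norm x)\<^sup>2 + r * D \<le> 2 ^ (CARD('n) + 2) * D"
    by (simp add: power_add power_divide field_simps)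
  moreover have "0 \<le> r * D" using r D by simp
  ultimately have le: "r * (norm x)\<^sup>2 \<le> 2 ^ (CARD('n) + 2) * D" by linarith
  define e :: real where "e = 2 ^ (CARD('n) + 2)"
  have e: "8 \<le> e"
  proof -
    have "(2::real) ^ 3 \<le> 2 ^ (CARD('n) + 2)" by (rule power_increasing) (auto simp: Suc_leI)
    then show ?thesis by (simp add: e_def)
  qed
  have "(e * d * \<sigma>)\<^sup>2 \<le> (norm x)\<^sup>2"
    using x e d \<sigma> by (intro power_mono) (auto simp: e_def d_def)
  then have "r * (e * d * \<sigma>)\<^sup>2 \<le> e * D"
    using le r by (smt (verit, best) e_def mult_left_mono)
  then have "(r * (e * d)) * (e * (d * \<sigma>\<^sup>2)) \<le> 1 * (e * (d * \<sigma>\<^sup>2))"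
    by (simp add: D_def power2_eq_square mult_ac)
  then have "r * (e * d) \<le> 1"
    using e d \<sigma> by (subst (asm) mult_le_cancel_right_pos) auto
  moreover have "r * 8 \<le> r * (e * d)"
    using r e d by (intro mult_left_mono) (smt (verit) mult_le_cancel_left1)
  ultimately have "r \<le> 1 / 8" by simp
  \<comment> \<open>Since \<open>exp 1 \<le> 3 < 8\<close>. As \<open>r\<^sup>2 = f x / M\<close>,
    squaring yields the factor \<open>exp (- 2)\<close>.\<close>
  also have "\<dots> \<le> exp (- 1)" using exp_le by (simp add: exp_minus field_simps)
  finally have "r\<^sup>2 \<le> (exp (- 1))\<^sup>2" using r by (intro power_mono) auto
  also have "(exp (- 1 :: real))\<^sup>2 = exp (- 2)" by (simp add: power2_eq_square flip: exp_add)
  finally show ?thesis using r M by (simp add: divide_le_eq mult.commute)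
qed

text \<open>Outside the ball of radius \<open>R\<close> the density is at most
  \<open>f p / e\<close>, so the almost-maximiser \<open>p\<close> lies inside. On a ray from
  \<open>p\<close>, the point at distance \<open>2 * R\<close> is outside, hence log-concavity makes
  \<open>ln f\<close> drop by at least 1 per length \<open>2 * R\<close> beyond it. The norm is
  finally bounded below by the mean of the coordinates' absolute values, so that the bound
  factorises.\<close>

lemma exponential_decay:
  "f x \<le> exp 3 * (2 ^ (CARD('n) + 3) * (3 * CARD('n) / \<sigma>) ^ CARD('n))
     * (\<Prod>i\<in>UNIV. exp (- (\<bar>x $ i\<bar> / (2 ^ (CARD('n) + 3) * CARD('n)\<^sup>2 * \<sigma>))))"
proof -
  define d where "d = real CARD('n)"
  have d: "1 \<le> d" by (simp add: d_def Suc_leI)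
  define R where "R = 2 ^ (CARD('n) + 2) * d * \<sigma>"
  have R: "0 < R" using d \<sigma> by (simp add: R_def)
  obtain p where p: "0 < f p" and max: "\<And>x. f x \<le> exp 1 * f p"
    using exists_almost_max by blast
  have far: "f y \<le> f p * exp (- 1)" if "R \<le> norm y" for y
  proof -
    have "f y \<le> exp 1 * f p * exp (- 2)"
      by (rule density_far_le) (use p max that in \<open>auto simp: R_def d_def\<close>)
    also have "\<dots> = f p * (exp 1 * exp (- 2))" by (simp only: mult_ac)
    also have "exp 1 * exp (- 2 :: real) = exp (- 1)" by (simp flip: exp_add)
    finally show ?thesis .
  qed
  have pR: "norm p < R"
  proof (rule ccontr)
    assume "\<not> norm p < R"
    then have "f p * 1 \<le> f p * exp (- 1)" using far[of p] by simp
    then show False using p by (subst (asm) mult_le_cancel_left_pos) auto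
  qed
  \<comment> \<open>Within distance \<open>2 * R\<close> the last factor is at least
    \<open>exp (- 1)\<close>, and \<open>exp 2\<close> leaves the \<open>exp 1\<close> of the
    almost-maximum.\<close>
  have decay: "f x \<le> exp 2 * f p * exp (- (norm (x - p) / (2 * R)))"
  proof (cases "norm (x - p) \<le> 2 * R")
    case True
    have "exp 1 * f p = exp 2 * f p * exp (- 1)" by (simp add: mult_ac flip: exp_add)
    also have "\<dots> \<le> exp 2 * f p * exp (- (norm (x - p) / (2 * R)))"
      using p True R by (intro mult_left_mono) (auto simp: divide_le_eq)
    finally show ?thesis using max[of x] by linarith
  next
    case False
    define t where "t = 2 * R / norm (x - p)"
    have "0 < norm (x - p)" using False R by linarith
    then have t: "0 < t" "t < 1" "t * norm (x - p) = 2 * R" using False R by (auto simp: t_def)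
    show ?thesis
    proof (cases "f x = 0")
      case False
      then have fx: "0 < f x" using nonneg[of x] by simp
      define y where "y = (1 - t) *\<^sub>R p + t *\<^sub>R x"
      have "y - p = t *\<^sub>R (x - p)" by (simp add: y_def algebra_simps)
      then have "norm (y - p) = 2 * R" using t by simp
      then have "R \<le> norm y" using pR norm_triangle_ineq4[of y p] by linarith
      have "f p powr (1 - t) * f x powr t \<le> f p * exp (- 1)"
        using lc[OF t(1,2), of p x] far[OF \<open>R \<le> norm y\<close>] by (simp add: y_def)
      then have "ln (f p powr (1 - t) * f x powr t) \<le> ln (f p * exp (- 1))"
        using p fx by (intro ln_mono) auto
      then have "t * (ln (f x) - ln (f p)) \<le> - 1"
        using p fx by (simp add: ln_mult ln_powr algebra_simps)
      then have "ln (f x) - ln (f p) \<le> - (norm (x - p) / (2 * R))"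
        using t R by (simp add: t_def field_simps split: if_splits)
      then have "ln (f x) \<le> ln (f p * exp (- (norm (x - p) / (2 * R))))"
        using p by (simp add: ln_mult)
      then have "f x \<le> f p * exp (- (norm (x - p) / (2 * R)))"
        using p fx by (subst (asm) ln_le_cancel_iff) auto
      also have "\<dots> \<le> exp 2 * (f p * exp (- (norm (x - p) / (2 * R))))"
        using p by simp
      finally show ?thesis by (simp only: mult.assoc)
    qed (use p in simp)
  qed
  have "(\<Sum>i\<in>UNIV. \<bar>x $ i\<bar>) \<le> (\<Sum>i\<in>(UNIV::'n set). norm x)"
    by (rule sum_mono) (rule component_le_norm_cart)
  then have "(\<Sum>i\<in>UNIV. \<bar>x $ i\<bar>) / d \<le> norm x" using d by (simp add: d_def divide_le_eq mult.commute)
  \<comment> \<open>Moving the centre from \<open>p\<close> to 0 costs \<open>R\<close>, that is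
    \<open>1 / 2\<close> in the exponent; it is rounded up to 1, which makes the prefactor
    \<open>exp 3\<close>.\<close>
  then have "(\<Sum>i\<in>UNIV. \<bar>x $ i\<bar>) / d - R \<le> norm (x - p)"
    using pR norm_triangle_ineq2[of x p] by linarith
  then have "((\<Sum>i\<in>UNIV. \<bar>x $ i\<bar>) / d - R) / (2 * R) \<le> norm (x - p) / (2 * R)"
    using R by (intro divide_right_mono) auto
  moreover have "((\<Sum>i\<in>UNIV. \<bar>x $ i\<bar>) / d - R) / (2 * R) = (\<Sum>i\<in>UNIV. \<bar>x $ i\<bar> / (2 * R * d)) - 1 / 2"
    using R d by (simp add: sum_divide_distrib[symmetric] field_simps)
  ultimately have "- (norm (x - p) / (2 * R)) \<le> 1 + (\<Sum>i\<in>UNIV. - (\<bar>x $ i\<bar> / (2 * R * d)))"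
    by (simp add: sum_negf)
  then have "exp (- (norm (x - p) / (2 * R))) \<le> exp 1 * (\<Prod>i\<in>UNIV. exp (- (\<bar>x $ i\<bar> / (2 * R * d))))"
    by (simp flip: exp_sum exp_add)
  then have "exp 2 * f p * exp (- (norm (x - p) / (2 * R)))
      \<le> exp 2 * f p * (exp 1 * (\<Prod>i\<in>UNIV. exp (- (\<bar>x $ i\<bar> / (2 * R * d)))))"
    using p by (intro mult_left_mono) auto
  also have "\<dots> = exp 3 * f p * (\<Prod>i\<in>UNIV. exp (- (\<bar>x $ i\<bar> / (2 * R * d))))"
  proof -
    have "exp (3::real) = exp 2 * exp 1" by (simp flip: exp_add)
    then show ?thesis by (simp only: mult_ac)
  qed
  also have "\<dots> \<le> exp 3 * (2 ^ (CARD('n) + 3) * (3 * CARD('n) / \<sigma>) ^ CARD('n))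
      * (\<Prod>i\<in>UNIV. exp (- (\<bar>x $ i\<bar> / (2 * R * d))))"
    by (intro mult_right_mono mult_left_mono density_le prod_nonneg) auto
  also have "2 * R * d = 2 ^ (CARD('n) + 3) * CARD('n)\<^sup>2 * \<sigma>"
    by (simp add: R_def d_def power_add power2_eq_square)
  finally show ?thesis using decay by linarith
qed

end

section \<open>Comparison of the lattice sum with the integral\<close>

text \<open>Infinite values of \<open>V\<close> are zeros of \<open>f\<close>, where the left side
  is 0; for finite values, exponentiate the convexity inequality.\<close>

lemma log_concave_powr:
  assumes "log_concave f" "0 < t" "t < 1"
  shows "f x powr (1 - t) * f y powr t \<le> f ((1 - t) *\<^sub>R x + t *\<^sub>R y)"
proof -
  obtain V where V: "convex_extended V" "\<And>x. f x = exp_neg (V x)"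
    using assms(1) by (auto simp: log_concave_def)
  have nonneg: "0 \<le> f z" for z by (simp add: V exp_neg_def)
  show ?thesis
  proof (cases "V x = \<infinity> \<or> V y = \<infinity>")
    case True
    then have "f x = 0 \<or> f y = 0" by (auto simp: V exp_neg_def)
    then show ?thesis using nonneg by auto
  next
    case False
    define z where "z = (1 - t) *\<^sub>R x + t *\<^sub>R y"
    have ninf: "V u \<noteq> -\<infinity>" for u using V(1) by (simp add: convex_extended_def)
    obtain a b where ab: "V x = ereal a" "V y = ereal b"
      using False ninf[of x] ninf[of y] by (cases "V x"; cases "V y") auto
    have le: "V z \<le> ereal ((1 - t) * a + t * b)"
      using V(1) assms(2,3) ab unfolding convex_extended_def z_def by (metis greaterThanLessThan_iff plus_ereal.simps(1) times_ereal.simps(1))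
    then obtain c where c: "V z = ereal c" using ninf[of z] by (cases "V z") auto
    then have "c \<le> (1 - t) * a + t * b" using le by simp
    then have "(1 - t) * - a + t * - b \<le> - c" by (simp add: algebra_simps)
    then show ?thesis
      using c ab by (simp add: V exp_neg_def z_def[symmetric] powr_def flip: exp_add)
  qed
qed

text \<open>Weighted arithmetic-geometric mean inequality. It makes the positive part of a signed
  coordinate log-concave.\<close>

lemma max_0_powr:
  fixes u v t :: real
  assumes "0 < t" "t < 1"
  shows "max 0 u powr (1 - t) * max 0 v powr t \<le> max 0 ((1 - t) * u + t * v)"
proof (cases "0 < u \<and> 0 < v")
  case True
  then show ?thesis
    using Youngs_inequality_0[of "1 - t" t u v] assms by (simp add: le_max_iff_disj)
qed auto

lemma has_bochner_integral_signed_sum: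
  fixes h :: "real \<Rightarrow> real \<Rightarrow> 'a \<Rightarrow> real"
  assumes "\<And>s s'. s \<in> A \<Longrightarrow> s' \<in> A \<Longrightarrow> integrable M (h s s')"
  shows "has_bochner_integral M (\<lambda>x. \<Sum>s\<in>A. \<Sum>s'\<in>A. s * s' * h s s' x)
    (\<Sum>s\<in>A. \<Sum>s'\<in>A. s * s' * integral\<^sup>L M (h s s'))"
  using assms
  by (intro has_bochner_integral_sum has_bochner_integral_mult_right has_bochner_integral_integrable)

section \<open>The four quadrants of the coordinates \<open>i\<close> and \<open>j\<close>\<close>

context isotropic_log_concave
begin

text \<open>A product of log-concave functions is log-concave. The factor
  \<open>x $ i * x $ j\<close> changes sign, but its quadrant parts are nonnegative products of
  log-concave functions.\<close>

lemma quadrant_quasiconcave: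
  fixes s s' :: real and i j :: 'n
  assumes "0 \<le> t" "t \<le> 1"
  defines "G \<equiv> \<lambda>x. f x * (max 0 (s * x $ i) * max 0 (s' * x $ j))"
  shows "min (G x) (G y) \<le> G ((1 - t) *\<^sub>R x + t *\<^sub>R y)"
proof (cases "t = 0 \<or> t = 1")
  case False
  then have t: "0 < t" "t < 1" using assms by auto
  let ?z = "(1 - t) *\<^sub>R x + t *\<^sub>R y"
  have G0: "0 \<le> G x" for x by (simp add: G_def nonneg)
  have m: "max 0 (a * x $ l) powr (1 - t) * max 0 (a * y $ l) powr t \<le> max 0 (a * ?z $ l)" for a l
    using max_0_powr[OF t, of "a * x $ l" "a * y $ l"] by (simp add: algebra_simps)
  have "min (G x) (G y) \<le> G x powr (1 - t) * G y powr t"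
    by (rule min_le_powr_mult_powr[OF G0 G0 t])
  also have "\<dots> = (f x powr (1 - t) * f y powr t)
      * ((max 0 (s * x $ i) powr (1 - t) * max 0 (s * y $ i) powr t)
      * (max 0 (s' * x $ j) powr (1 - t) * max 0 (s' * y $ j) powr t))"
    by (simp add: G_def powr_mult nonneg mult_ac)
  also have "\<dots> \<le> G ?z"
    unfolding G_def by (intro mult_mono lc[OF t] m) (auto simp: nonneg)
  finally show ?thesis .
qed auto

text \<open>Apply \<open>integral_minus_lattice_sum_le\<close> to each quadrant. Here
  \<open>M\<close> has order \<open>\<sigma>\<close> to the power \<open>- d\<close>, division by
  \<open>a\<^sup>2\<close> raises the exponent by 2, and \<open>(3 / a) ^ (d - 1)\<close> by
  \<open>d - 1\<close>, leaving order \<open>\<sigma>\<close>; the 4 counts the quadrants.\<close>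

lemma lattice_second_moment:
  assumes \<sigma>1: "1 \<le> \<sigma>" and ij: "i \<noteq> j"
  defines "d \<equiv> CARD('n)"
  defines "c \<equiv> 2 ^ (d + 3) * (real d)\<^sup>2"
  shows "integrable (count_space UNIV) (\<lambda>k. f (of_int_vec k) * real_of_int (k $ i) * real_of_int (k $ j))"
    and "\<bar>LINT k|count_space UNIV. f (of_int_vec k) * real_of_int (k $ i) * real_of_int (k $ j)\<bar>
      \<le> 4 * (d * (exp 3 * (2 ^ (d + 3) * (3 * real d) ^ d) * (2 * c)\<^sup>2 * (6 * c) ^ (d - 1))) * \<sigma>"
proof -
  have d: "1 \<le> real d" by (simp add: d_def Suc_leI)
  have c: "1 \<le> c"
  proof -
    have "1 * 1 \<le> (2::real) ^ (d + 3) * (real d)\<^sup>2"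
      using d by (intro mult_mono) (auto simp: one_le_power)
    then show ?thesis by (simp add: c_def)
  qed
  \<comment> \<open>Half the decay rate of \<open>f\<close>: the other half absorbs the growth of
    the two coordinates.\<close>
  define a where "a = 1 / (2 * c * \<sigma>)"
  have a: "0 < a" "a \<le> 1"
  proof -
    have "1 * 1 \<le> c * \<sigma>" using c \<sigma>1 by (intro mult_mono) auto
    moreover from this have "0 < c * \<sigma>" by linarith
    ultimately show "0 < a" "a \<le> 1" by (auto simp: a_def divide_le_eq mult.assoc)
  qed
  define M where "M = exp 3 * (2 ^ (d + 3) * (3 * real d / \<sigma>) ^ d)"
  have M: "0 \<le> M" using \<sigma> by (simp add: M_def)
  define K where "K = M / a\<^sup>2"
  have K: "0 \<le> K" using M by (simp add: K_def)
  define E where "E = d * (K * (3 / a) ^ (d - 1))"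
  have E_eq: "E = d * (exp 3 * (2 ^ (d + 3) * (3 * real d) ^ d) * (2 * c)\<^sup>2 * (6 * c) ^ (d - 1)) * \<sigma>"
  proof -
    have "\<sigma> ^ d = \<sigma> * \<sigma> ^ (d - 1)" using d by (metis One_nat_def Suc_pred d_def power_Suc zero_less_card_finite)
    then have "\<sigma>\<^sup>2 * \<sigma> ^ (d - 1) / \<sigma> ^ d = \<sigma>" using \<sigma> by (simp add: power2_eq_square)
    moreover have "E = d * (exp 3 * (2 ^ (d + 3) * (3 * real d) ^ d) * (2 * c)\<^sup>2 * (6 * c) ^ (d - 1))
        * (\<sigma>\<^sup>2 * \<sigma> ^ (d - 1) / \<sigma> ^ d)"
      by (simp add: E_def K_def M_def a_def power_mult_distrib power_divide)
    ultimately show ?thesis by simp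
  qed
  define G where "G s s' x = f x * (max 0 (s * x $ i) * max 0 (s' * x $ j))" for s s' :: real and x
  have G0: "0 \<le> G s s' x" for s s' x by (simp add: G_def nonneg)
  have Gm: "G s s' \<in> borel_measurable borel" for s s'
    unfolding G_def by measurable
  have Gle: "G s s' x \<le> f x * (\<bar>x $ i\<bar> * \<bar>x $ j\<bar>)" if "s \<in> {1, -1}" "s' \<in> {1, -1}" for s s' x
    unfolding G_def using that by (intro mult_left_mono mult_mono nonneg) auto
  have bound: "G s s' x \<le> K * (\<Prod>l\<in>UNIV. exp (- (a * \<bar>x $ l\<bar>)))"
    if s: "s \<in> {1, -1}" "s' \<in> {1, -1}" for s s' x
  proof -
    have lin: "\<bar>u\<bar> \<le> exp (a * \<bar>u\<bar>) / a" for u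
    proof -
      have "a * \<bar>u\<bar> \<le> exp (a * \<bar>u\<bar>)" using exp_ge_add_one_self[of "a * \<bar>u\<bar>"] by linarith
      then show ?thesis using a by (simp add: le_divide_eq mult.commute)
    qed
    have "\<bar>x $ i\<bar> * \<bar>x $ j\<bar> \<le> (exp (a * \<bar>x $ i\<bar>) / a) * (exp (a * \<bar>x $ j\<bar>) / a)"
      using a by (intro mult_mono lin) auto
    also have "\<dots> = exp (a * \<bar>x $ i\<bar> + a * \<bar>x $ j\<bar>) / a\<^sup>2"
      by (simp add: exp_add power2_eq_square)
    \<comment> \<open>Because \<open>i\<close> and \<open>j\<close> differ, each coordinate uses its
      spare decay at most once.\<close>
    also have "a * \<bar>x $ i\<bar> + a * \<bar>x $ j\<bar> = (\<Sum>l\<in>{i, j}. a * \<bar>x $ l\<bar>)" using ij by simp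
    also have "exp (\<Sum>l\<in>{i, j}. a * \<bar>x $ l\<bar>) / a\<^sup>2 \<le> exp (\<Sum>l\<in>UNIV. a * \<bar>x $ l\<bar>) / a\<^sup>2"
      using a by (intro divide_right_mono) (auto intro!: sum_mono2)
    finally have xx: "\<bar>x $ i\<bar> * \<bar>x $ j\<bar> \<le> (\<Prod>l\<in>UNIV. exp (a * \<bar>x $ l\<bar>)) / a\<^sup>2"
      by (simp add: exp_sum)
    have "f x \<le> M * (\<Prod>l\<in>UNIV. exp (- (\<bar>x $ l\<bar> / (c * \<sigma>))))"
      using exponential_decay[of x] by (simp add: M_def c_def d_def)
    also have "(\<lambda>l. \<bar>x $ l\<bar> / (c * \<sigma>)) = (\<lambda>l. 2 * a * \<bar>x $ l\<bar>)"
      by (simp add: a_def fun_eq_iff)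
    finally have fx: "f x \<le> M * (\<Prod>l\<in>UNIV. exp (- (2 * a * \<bar>x $ l\<bar>)))" .
    have "G s s' x \<le> f x * (\<bar>x $ i\<bar> * \<bar>x $ j\<bar>)" by (rule Gle[OF s])
    also have "\<dots> \<le> (M * (\<Prod>l\<in>UNIV. exp (- (2 * a * \<bar>x $ l\<bar>)))) * ((\<Prod>l\<in>UNIV. exp (a * \<bar>x $ l\<bar>)) / a\<^sup>2)"
      using M by (intro mult_mono fx xx) (auto intro!: mult_nonneg_nonneg prod_nonneg)
    also have "\<dots> = K * (\<Prod>l\<in>UNIV. exp (- (2 * a * \<bar>x $ l\<bar>)) * exp (a * \<bar>x $ l\<bar>))"
      by (simp add: K_def prod.distrib)
    also have "\<dots> = K * (\<Prod>l\<in>UNIV. exp (- (a * \<bar>x $ l\<bar>)))"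
      by (simp flip: exp_add)
    finally show ?thesis .
  qed
  have mom: "has_bochner_integral lborel (\<lambda>x. f x * (x $ i * x $ j)) 0"
    using second_moment[of i j] ij by simp
  have Gint: "integrable lborel (G s s')" if s: "s \<in> {1, -1}" "s' \<in> {1, -1}" for s s'
  proof (rule Bochner_Integration.integrable_bound)
    show "integrable lborel (\<lambda>x. f x * (x $ i * x $ j))" using mom by (simp add: has_bochner_integral_iff)
    show "AE x in lborel. norm (G s s' x) \<le> norm (f x * (x $ i * x $ j))"
      using Gle[OF s] G0 by (simp add: abs_mult nonneg)
  qed (use Gm in simp)
  have qc: "min (G s s' x) (G s s' y) \<le> G s s' ((1 - t) *\<^sub>R x + t *\<^sub>R y)" if "0 \<le> t" "t \<le> 1" for s s' x y t
    unfolding G_def by (rule quadrant_quasiconcave[OF that])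
  have cmp: "integrable (count_space UNIV) (\<lambda>k. G s s' (of_int_vec k))"
    "\<bar>(LINT k|count_space UNIV. G s s' (of_int_vec k)) - (LINT x|lborel. G s s' x)\<bar> \<le> E"
    if s: "s \<in> {1, -1}" "s' \<in> {1, -1}" for s s'
    unfolding E_def d_def
    by (rule integral_minus_lattice_sum_le[OF Gm G0 qc a K bound[OF s] Gint[OF s]]; assumption)+
  \<comment> \<open>Each coordinate is the difference of its positive and negative parts.\<close>
  have split: "f x * x $ i * x $ j = (\<Sum>s\<in>{1, -1}. \<Sum>s'\<in>{1, -1}. s * s' * G s s' x)" for x
    by (simp add: G_def max_def algebra_simps)
  have split_k: "f (of_int_vec k) * real_of_int (k $ i) * real_of_int (k $ j)
      = (\<Sum>s\<in>{1, -1}. \<Sum>s'\<in>{1, -1}. s * s' * G s s' (of_int_vec k))" for k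
    using split[of "of_int_vec k"] by (simp add: of_int_vec_def)
  let ?S = "\<lambda>s s'. LINT k|count_space UNIV. G s s' (of_int_vec k)"
  let ?I = "\<lambda>s s'. LINT x|lborel. G s s' x"
  have lattice: "has_bochner_integral (count_space UNIV)
      (\<lambda>k. f (of_int_vec k) * real_of_int (k $ i) * real_of_int (k $ j))
      (\<Sum>s\<in>{1, -1}. \<Sum>s'\<in>{1, -1}. s * s' * ?S s s')"
    unfolding split_k by (rule has_bochner_integral_signed_sum) (rule cmp(1))
  then show "integrable (count_space UNIV) (\<lambda>k. f (of_int_vec k) * real_of_int (k $ i) * real_of_int (k $ j))"
    by (simp add: has_bochner_integral_iff)
  have "has_bochner_integral lborel (\<lambda>x. f x * x $ i * x $ j)
      (\<Sum>s\<in>{1, -1}. \<Sum>s'\<in>{1, -1}. s * s' * ?I s s')"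
    unfolding split by (rule has_bochner_integral_signed_sum) (rule Gint)
  \<comment> \<open>The signed integrals recombine to the off-diagonal covariance; subtracting this
    zero pairs each lattice sum with its integral.\<close>
  then have I: "(\<Sum>s\<in>{1, -1::real}. \<Sum>s'\<in>{1, -1}. s * s' * ?I s s') = 0"
    using mom by (simp only: has_bochner_integral_iff mult.assoc)
  have "(LINT k|count_space UNIV. f (of_int_vec k) * real_of_int (k $ i) * real_of_int (k $ j))
      = (\<Sum>s\<in>{1, -1}. \<Sum>s'\<in>{1, -1}. s * s' * ?S s s') - (\<Sum>s\<in>{1, -1}. \<Sum>s'\<in>{1, -1}. s * s' * ?I s s')"
    using lattice unfolding I by (simp only: has_bochner_integral_iff diff_zero)
  also have "\<dots> = (\<Sum>s\<in>{1, -1::real}. \<Sum>s'\<in>{1, -1}. s * s' * (?S s s' - ?I s s'))"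
    by (simp add: right_diff_distrib sum_subtractf)
  also have "\<bar>\<dots>\<bar> \<le> 4 * E"
    using cmp(2)[of 1 1] cmp(2)[of 1 "-1"] cmp(2)[of "-1" 1] cmp(2)[of "-1" "-1"]
    by simp
  finally show "\<bar>LINT k|count_space UNIV. f (of_int_vec k) * real_of_int (k $ i) * real_of_int (k $ j)\<bar>
      \<le> 4 * (d * (exp 3 * (2 ^ (d + 3) * (3 * real d) ^ d) * (2 * c)\<^sup>2 * (6 * c) ^ (d - 1))) * \<sigma>"
    unfolding E_eq by (simp only: mult.assoc)
qed

end

text \<open>Integrability has to be recovered from the values of the integrals. A non-integrable
  diagonal integrand would have integral 0, not \<open>\<sigma>\<^sup>2\<close>; the mixed
  integrands are dominated by sums of diagonal ones.\<close>

lemma isotropic_log_concaveI: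
  fixes f :: "real^'n::finite \<Rightarrow> real"
  assumes \<sigma>: "0 < \<sigma>" and dens: "is_density f" and lc: "log_concave f" and cent: "centered f"
    and cov: "covariance_matrix f = \<sigma>\<^sup>2 *\<^sub>R mat 1"
  shows "isotropic_log_concave f \<sigma>"
proof
  show nonneg: "0 \<le> f x" for x using dens by (simp add: is_density_def)
  show total: "has_bochner_integral lborel f 1" using dens by (simp add: is_density_def)
  show mean: "has_bochner_integral lborel (\<lambda>x. f x *\<^sub>R x) 0" using cent by (simp add: centered_def)
  have [measurable]: "f \<in> borel_measurable borel"
    using total borel_measurable_has_bochner_integral by fastforce
  have "density_mean f = 0"
    using mean by (simp add: density_mean_def has_bochner_integral_iff)
  then have int: "(LINT x|lborel. f x * (x $ i * x $ j)) = (if i = j then \<sigma>\<^sup>2 else 0)" for i j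
    using arg_cong[OF cov, of "\<lambda>A. A $ i $ j"] by (simp add: covariance_matrix_def mat_def)
  have diag: "integrable lborel (\<lambda>x. f x * (x $ i * x $ i))" for i
  proof (rule ccontr)
    assume "\<not> ?thesis"
    then show False using int[of i i] \<sigma> by (simp add: not_integrable_integral_eq)
  qed
  have "integrable lborel (\<lambda>x. f x * (x $ i * x $ j))" for i j
  proof (rule Bochner_Integration.integrable_bound)
    show "integrable lborel (\<lambda>x. f x * (x $ i * x $ i) + f x * (x $ j * x $ j))"
      by (intro Bochner_Integration.integrable_add diag)
    have "\<bar>u * v\<bar> \<le> u * u + v * v" for u v :: real
    proof -
      have "2 * \<bar>u\<bar> * \<bar>v\<bar> \<le> u * u + v * v"
        using sum_squares_bound[of "\<bar>u\<bar>" "\<bar>v\<bar>"] by (simp add: power2_eq_square)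
      moreover have "0 \<le> \<bar>u\<bar> * \<bar>v\<bar>" by simp
      ultimately show ?thesis unfolding abs_mult by linarith
    qed
    then have "f x * \<bar>x $ i * x $ j\<bar> \<le> f x * (x $ i * x $ i + x $ j * x $ j)" for x
      by (intro mult_left_mono nonneg)
    then show "AE x in lborel. norm (f x * (x $ i * x $ j)) \<le> norm (f x * (x $ i * x $ i) + f x * (x $ j * x $ j))"
      using nonneg by (auto simp: abs_mult distrib_left intro: order_trans[OF _ abs_ge_self])
  qed measurable
  then show "has_bochner_integral lborel (\<lambda>x. f x * (x $ i * x $ j)) (if i = j then \<sigma>\<^sup>2 else 0)" for i j
    using int by (simp only: has_bochner_integral_iff)
qed (use \<sigma> log_concave_powr[OF lc] in auto)

theorem proposition32:
  assumes "CARD('n::finite) \<ge> 2"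
  shows "\<exists>C N :: real. C > 0 \<and> N > 0 \<and>
    (\<forall>(f :: real ^ 'n \<Rightarrow> real) (\<sigma> :: real) (i :: 'n) (j :: 'n).
       is_density f \<and> log_concave f \<and> continuous_on UNIV f \<and> centered f \<and>
       isotropic f \<and> covariance_matrix f = \<sigma>\<^sup>2 *\<^sub>R mat 1 \<and> \<sigma> \<ge> N \<and> i \<noteq> j \<longrightarrow>
       (\<lambda>k :: int ^ 'n. f (of_int_vec k) * real_of_int (k $ i) * real_of_int (k $ j)) summable_on UNIV \<and>
       \<bar>\<Sum>\<^sub>\<infinity>k :: int ^ 'n. f (of_int_vec k) * real_of_int (k $ i) * real_of_int (k $ j)\<bar> \<le> C * \<sigma>)"
proof -
  define d where "d = CARD('n)"
  have d: "0 < real d" by (simp add: d_def)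
  define c :: real where "c = 2 ^ (d + 3) * (real d)\<^sup>2"
  have c: "0 < c" using d by (simp add: c_def)
  define C where "C = 4 * (d * (exp 3 * (2 ^ (d + 3) * (3 * real d) ^ d) * (2 * c)\<^sup>2 * (6 * c) ^ (d - 1)))"
  have "0 < C" using d c by (simp add: C_def)
  moreover have "(\<lambda>k. f (of_int_vec k) * real_of_int (k $ i) * real_of_int (k $ j)) summable_on UNIV \<and>
      \<bar>\<Sum>\<^sub>\<infinity>k. f (of_int_vec k) * real_of_int (k $ i) * real_of_int (k $ j)\<bar> \<le> C * \<sigma>"
    if f: "is_density f" "log_concave f" "centered f" "covariance_matrix f = \<sigma>\<^sup>2 *\<^sub>R mat 1" "1 \<le> \<sigma>" "i \<noteq> j"
    for f :: "real ^ 'n \<Rightarrow> real" and \<sigma> i j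
  proof -
    interpret isotropic_log_concave f \<sigma>
      by (rule isotropic_log_concaveI) (use f in auto)
    let ?g = "\<lambda>k. f (of_int_vec k) * real_of_int (k $ i) * real_of_int (k $ j)"
    \<comment> \<open>Integrability for counting measure is absolute summability, which gives
      \<open>summable_on\<close> and identifies \<open>infsum\<close> with the integral.\<close>
    have abs: "Infinite_Set_Sum.abs_summable_on ?g UNIV"
      unfolding Infinite_Set_Sum.abs_summable_on_def by (rule lattice_second_moment(1)) (use f in auto)
    have "?g summable_on UNIV"
      using abs abs_summable_equivalent abs_summable_summable by blast
    moreover have "infsum ?g UNIV = (LINT k|count_space UNIV. ?g k)"
      using infsetsum_infsum[OF abs] by (simp add: infsetsum_def)
    moreover have "\<bar>LINT k|count_space UNIV. ?g k\<bar> \<le> C * \<sigma>"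
      unfolding C_def c_def d_def by (rule lattice_second_moment(2)) (use f in auto)
    ultimately show ?thesis by simp
  qed
  ultimately show ?thesis
    \<comment> \<open>The threshold 1 is what \<open>lattice_second_moment\<close> asks of
      \<open>\<sigma>\<close>; it ensures \<open>a \<le> 1\<close> there.\<close>
    by (intro exI[of _ C] exI[of _ 1]) auto
qed

end
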